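(* Let $T_0=\{n/3^k: n\in\mathbf{N} \text{ stable},\ k\in\mathbf{Z}_{\ge0},\ \|n\|=3k+2\}$ and $K=\overline{T_0}$ (closure in $\mathbf{R}$). Then $K$ is an arithmetic compact set with module $\mu=3$ and ratio $\rho=3$, and its stability gauge coincides with the stable complexity: $\|n\|_K=\|n\|_{\mathrm{st}}$ for all $n\in\mathbf{N}$.
   Context: The complexity $\|n\|$ of $n\in\mathbf{N}$ is the least number of occurrences of the symbol $1$ in an expression equal to $n$ built only from $1$, $+$, $\times$ and parentheses. A natural number $n$ is stable if $\|3^k n\|=\|n\|+3k$ for all $k\ge0$. (It is known that for each $n$ there is $a\ge0$ with $3^a n$ stable.) The stable complexity is $\|n\|_{\mathrm{st}}=\|3^a n\|-3a$ for any $a$ with $3^a n$ stable. For $A\subset\mathbf{R}$, $A'$ is the derived set, $A^{(0)}=A$, $A^{(n+1)}=(A^{(n)})'$. The reverse usual order is $x\preccurlyeq y$ iff $x\ge y$; for a set $L$ well ordered by $\preccurlyeq$, $L[\alpha]$ is its element in position $\alpha$ (from $0$). A self-similar compact set of ratio $\rho>1$ and module $\mu\in\mathbf{N}$ is a compact $K\subset[0,\infty)$ with $\rho K^{(\mu)}=K$, well ordered by $\preccurlyeq$, of order type $\omega^\omega+1$; put $T_u(K)=K^{(u)}\setminus K^{(u+1)}$. $K$ is quasi-arithmetic if $\rho\ge2$ is an integer and there is $\kappa\colon\mathbf{N}\setminus\rho\mathbf{N}\to\mathbf{Z}_{\ge0}$ with $K\setminus\{0\}=\{m/\rho^k:\rho\nmid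 m,\ k\ge\kappa(m)\}$. For $n\in\mathbf{N}$ choose $\ell\in\mathbf{Z}$, $u\ge0$ with $n/\rho^\ell\in T_u(K)$; the stability gauge is $\|n\|_K=\ell\mu+d-u$ (independent of the choice), with the constant $d$ chosen so that $\|1\|_K=0$. A quasi-arithmetic $K$ is an arithmetic compact if for every ordinal $0\le\alpha<\omega^\omega$ and every $u\ge0$, writing $T_{u+1}(K)[\alpha]=n/\rho^k$ with $\rho\nmid n$, the sets $\{T_u(K)[\omega\alpha+r]: r\ge0\}$ and $\{b(a\rho^r+1)/\rho^{r+k}: a,b\in\mathbf{N},\ n=ab,\ \|n\|_K=\|a\|_K+\|b\|_K,\ r\ge0\}$ have finite symmetric difference. *)

theory Defs
  imports "HOL-Analysis.Analysis"
begin

datatype expr = One | Plus expr expr | Times expr expr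

fun eval_expr :: "expr \<Rightarrow> nat" where
  "eval_expr One = 1"
| "eval_expr (Plus a b) = eval_expr a + eval_expr b"
| "eval_expr (Times a b) = eval_expr a * eval_expr b"

fun ones :: "expr \<Rightarrow> nat" where
  "ones One = 1"
| "ones (Plus a b) = ones a + ones b"
| "ones (Times a b) = ones a + ones b"

text \<open>Complexity of n (meaningful for n \<ge> 1).\<close>
definition cpx :: "nat \<Rightarrow> nat" where
  "cpx n = (LEAST c. \<exists>e. eval_expr e = n \<and> ones e = c)"

definition stable :: "nat \<Rightarrow> bool" where
  "stable n \<longleftrightarrow> (\<forall>k. cpx (3 ^ k * n) = cpx n + 3 * k)"

text \<open>Stable complexity, computed with the least a such that 3^a n is stable
  (the paper notes the value does not depend on the choice of a).\<close>
definition stable_cpx :: "nat \<Rightarrow> int" where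
  "stable_cpx n = (let a = (LEAST a. stable (3 ^ a * n)) in int (cpx (3 ^ a * n)) - 3 * int a)"

definition derived :: "real set \<Rightarrow> real set" where
  "derived A = {x. x islimpt A}"

definition iter_derived :: "nat \<Rightarrow> real set \<Rightarrow> real set" where
  "iter_derived n A = (derived ^^ n) A"

definition Tlayer :: "nat \<Rightarrow> real set \<Rightarrow> real set" where
  "Tlayer u K = iter_derived u K - iter_derived (Suc u) K"

text \<open>Ordinals below omega^omega are represented by their Cantor normal form
  coefficients: f represents sum over i of omega^i * f i (finite support).\<close>
definition OmegaOmega :: "(nat \<Rightarrow> nat) set" where
  "OmegaOmega = {f. finite {i. f i \<noteq> 0}}"

definition oo_less :: "(nat \<Rightarrow> nat) \<Rightarrow> (nat \<Rightarrow> nat) \<Rightarrow> bool" where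
  "oo_less f g \<longleftrightarrow> (\<exists>i. f i < g i \<and> (\<forall>j>i. f j = g j))"

text \<open>omega^omega + 1: None is the top element.\<close>
fun oo1_less :: "(nat \<Rightarrow> nat) option \<Rightarrow> (nat \<Rightarrow> nat) option \<Rightarrow> bool" where
  "oo1_less (Some f) (Some g) = oo_less f g"
| "oo1_less (Some f) None = True"
| "oo1_less None _ = False"

definition oo_omega_mult_plus :: "(nat \<Rightarrow> nat) \<Rightarrow> nat \<Rightarrow> (nat \<Rightarrow> nat)" where
  "oo_omega_mult_plus \<alpha> r = (\<lambda>i. if i = 0 then r else \<alpha> (i - 1))"

definition rev_well_ordered :: "real set \<Rightarrow> bool" where
  "rev_well_ordered S \<longleftrightarrow> (\<forall>A. A \<subseteq> S \<and> A \<noteq> {} \<longrightarrow> (\<exists>m\<in>A. \<forall>y\<in>A. y \<le> m))"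

definition order_type_oo1 :: "real set \<Rightarrow> bool" where
  "order_type_oo1 S \<longleftrightarrow> (\<exists>h. bij_betw h S (Some ` OmegaOmega \<union> {None}) \<and>
      (\<forall>x\<in>S. \<forall>y\<in>S. x > y \<longleftrightarrow> oo1_less (h x) (h y)))"

definition is_pos :: "real set \<Rightarrow> (nat \<Rightarrow> nat) \<Rightarrow> real \<Rightarrow> bool" where
  "is_pos L \<alpha> x \<longleftrightarrow> x \<in> L \<and> \<alpha> \<in> OmegaOmega \<and>
     (\<exists>h. bij_betw h {y\<in>L. y > x} {\<beta>\<in>OmegaOmega. oo_less \<beta> \<alpha>} \<and>
        (\<forall>y\<in>{y\<in>L. y > x}. \<forall>z\<in>{y\<in>L. y > x}. y > z \<longleftrightarrow> oo_less (h y) (h z)))"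

definition self_similar :: "real set \<Rightarrow> real \<Rightarrow> nat \<Rightarrow> bool" where
  "self_similar K \<rho> \<mu> \<longleftrightarrow> \<rho> > 1 \<and> compact K \<and> K \<subseteq> {0..} \<and>
     (\<lambda>x. \<rho> * x) ` iter_derived \<mu> K = K \<and> rev_well_ordered K \<and> order_type_oo1 K"

definition quasi_arithmetic :: "real set \<Rightarrow> nat \<Rightarrow> nat \<Rightarrow> bool" where
  "quasi_arithmetic K \<rho> \<mu> \<longleftrightarrow> self_similar K (real \<rho>) \<mu> \<and> \<rho> \<ge> 2 \<and>
     (\<exists>\<kappa> :: nat \<Rightarrow> nat. K - {0} =
        {real m / real \<rho> ^ k | m k. m > 0 \<and> \<not> \<rho> dvd m \<and> k \<ge> \<kappa> m})"

text \<open>Stability stab_gauge: choose l and u with n / rho^l in T_u(K); value l*mu + d - u,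
  normalised by d so that the stab_gauge of 1 is 0.\<close>
definition stab_gauge_raw :: "real set \<Rightarrow> nat \<Rightarrow> nat \<Rightarrow> nat \<Rightarrow> int" where
  "stab_gauge_raw K \<rho> \<mu> n = (let p = (SOME p :: int \<times> nat.
       real n / (real \<rho>) powi (fst p) \<in> Tlayer (snd p) K)
     in fst p * int \<mu> - int (snd p))"

definition stab_gauge :: "real set \<Rightarrow> nat \<Rightarrow> nat \<Rightarrow> nat \<Rightarrow> int" where
  "stab_gauge K \<rho> \<mu> n = stab_gauge_raw K \<rho> \<mu> n - stab_gauge_raw K \<rho> \<mu> 1"

definition arithmetic_compact :: "real set \<Rightarrow> nat \<Rightarrow> nat \<Rightarrow> bool" where
  "arithmetic_compact K \<rho> \<mu> \<longleftrightarrow> quasi_arithmetic K \<rho> \<mu> \<and>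
     (\<forall>\<alpha>\<in>OmegaOmega. \<forall>u n k x. is_pos (Tlayer (Suc u) K) \<alpha> x \<longrightarrow> n > 0 \<longrightarrow> \<not> \<rho> dvd n \<longrightarrow>
        x = real n / real \<rho> ^ k \<longrightarrow>
        (let A = {y. \<exists>r. is_pos (Tlayer u K) (oo_omega_mult_plus \<alpha> r) y};
             B = {real b * (real a * real \<rho> ^ r + 1) / real \<rho> ^ (r + k) | a b r.
                    a > 0 \<and> b > 0 \<and> n = a * b \<and> stab_gauge K \<rho> \<mu> n = stab_gauge K \<rho> \<mu> a + stab_gauge K \<rho> \<mu> b}
         in finite ((A - B) \<union> (B - A))))"

definition T0 :: "real set" where
  "T0 = {real n / 3 ^ k | n k. n > 0 \<and> stable n \<and> cpx n = 3 * k + 2}"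

end

theory Submission
  imports Defs
begin

text \<open>
  Extend the stable complexity to the numbers \<open>n / 3 ^ k\<close> by subtracting \<open>3 * k\<close>; then \<open>T\<^sub>0\<close> is the set
  of ternary rationals of complexity \<open>2\<close>. Everything rests on one compactness statement: a sequence
  of complexity at most \<open>c\<close> that stays away from \<open>0\<close> has a subsequence that is constant or tends
  from above to a limit of complexity at most \<open>c - 1\<close>, and if the limit has complexity exactly \<open>c - 1\<close>, the terms
  are \<open>\<beta> * (\<alpha> + 3 ^ r)\<close> with \<open>\<alpha> * \<beta>\<close> an optimal factorisation of the limit. It is proved by induction on
  the defect, measured by \<open>3 powr c / x ^ 3\<close>. An optimal expression is a product or a sum. In a product
  both factors that are not powers of \<open>3\<close> have smaller defect, by a factor of at least \<open>9/8\<close>. In a sum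
  the defect bounds the smaller summand, so along a subsequence it is a constant that becomes
  negligible, while the larger summand has smaller complexity.

  Hence the numbers of complexity at most \<open>c\<close> together with \<open>0\<close> form a compact set, well ordered by
  \<open>\<ge>\<close>, whose derived set is the one for \<open>c - 1\<close>. The Cantor normal form of a position is read off by
  counting, for each \<open>u\<close>, points of the \<open>u\<close>-th layer.
\<close>

section \<open>Complexity and stable complexity\<close>

text \<open>The bound \<open>n ^ 3 \<le> 3 ^ cpx n\<close> keeps the defect at least
  \<open>1\<close>, and along an optimal product defects multiply. Powers of \<open>3\<close> have
  defect exactly \<open>1\<close>, so splitting them off makes no progress; this obstacle forces
  their separate treatment and the passage to the stable complexity, for which a factor
  \<open>3\<close> always costs exactly \<open>3\<close>. The distance \<open>e > 0\<close> from
  \<open>0\<close> is what bounds the defect. The shape of the terms comes from counting losses.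
  Freezing a summand \<open>b\<close> costs \<open>cpx b\<close>, so a loss of exactly one means
  \<open>b = 1\<close> and terms \<open>\<alpha> + 1 / 3 ^ k\<close>. A constant factor preserves
  this shape, whereas two factors that both converge properly lose two together. Equality in all
  these estimates makes the factorisation of the limit optimal, and this is the origin of the
  additivity condition on \<open>a\<close> and \<open>b\<close> in an arithmetic compact set.
  Approach from above only is what gives the well order.\<close>

lemma eval_expr_pos: "eval_expr e \<ge> 1"
  by (induction e) auto

lemma ones_pos: "ones e \<ge> 1"
  by (induction e) auto

section \<open>Cubes of sums against powers of three\<close>

lemma pow3_ge_9: "2 ^ 3 \<le> (3::nat) ^ k \<Longrightarrow> 9 \<le> (3::nat) ^ k"
proof -
  assume *: "2 ^ 3 \<le> (3::nat) ^ k"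
  have "k \<ge> 2"
  proof (rule ccontr)
    assume "\<not> k \<ge> 2"
    then have "(3::nat) ^ k \<le> 3 ^ 1" by (intro power_increasing) auto
    with * show False by simp
  qed
  then have "(3::nat) ^ 2 \<le> 3 ^ k" by (intro power_increasing) auto
  then show ?thesis by simp
qed

text \<open>For summands at least \<open>3\<close>, \<open>3 * (a + b) \<le> 2 * (a * b)\<close>
  puts the cube of the sum below \<open>8/27\<close> of the product of the bounds. Small summands
  rely on integer exponents: \<open>2 ^ 3 \<le> 3 ^ i\<close> already means
  \<open>9 \<le> 3 ^ i\<close>. The sum \<open>1 + 2\<close> is set apart because \<open>3\<close>
  is itself a power of \<open>3\<close>.\<close>

lemma sum_cube_gap:
  fixes a b i j :: nat
  assumes "1 \<le> a" "a \<le> b" "1 \<le> i" "1 \<le> j" "a ^ 3 \<le> 3 ^ i" "b ^ 3 \<le> 3 ^ j"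
  shows "(a + b = 3 \<and> 3 ^ 3 \<le> (3::nat) ^ (i + j)) \<or> 9 * (a + b) ^ 3 \<le> 8 * 3 ^ (i + j)"
proof -
  have i3: "(3::nat) ^ 1 \<le> 3 ^ i" and j3: "(3::nat) ^ 1 \<le> 3 ^ j"
    using assms by (intro power_increasing; simp)+
  consider "a = 1 \<and> b = 1" | "a = 1 \<and> b = 2" | "a = 1 \<and> b \<ge> 3" | "a = 2 \<and> b = 2"
    | "a = 2 \<and> b \<ge> 3" | "a \<ge> 3 \<and> b \<ge> 3"
    using assms by linarith
  then show ?thesis
  proof cases
    case 1
    have "3 * 3 \<le> (3::nat) ^ i * 3 ^ j" using i3 j3 by (intro mult_mono) auto
    moreover have ab: "a + b = 2" using 1 by simp
    ultimately show ?thesis unfolding ab by (simp add: power_add)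
  next
    case 2
    have "3 * 9 \<le> (3::nat) ^ i * 3 ^ j"
      using i3 pow3_ge_9[of j] 2 assms by (intro mult_mono) auto
    then show ?thesis using 2 by (simp add: power_add)
  next
    case 3
    then have "3 * (a + b) \<le> 4 * b" by simp
    then have "(3 * (a + b)) ^ 3 \<le> (4 * b) ^ 3" by (rule power_mono) simp
    then have A: "27 * (a + b) ^ 3 \<le> 64 * b ^ 3" unfolding power_mult_distrib by simp
    have "3 * b ^ 3 \<le> 3 ^ i * 3 ^ j" using i3 assms by (intro mult_mono) auto
    then show ?thesis using A by (simp add: power_add)
  next
    case 4
    have "9 * 9 \<le> (3::nat) ^ i * 3 ^ j"
      using pow3_ge_9[of i] pow3_ge_9[of j] 4 assms by (intro mult_mono) auto
    then show ?thesis using 4 by (simp add: power_add)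
  next
    case 5
    then have "3 * (a + b) \<le> 5 * b" by simp
    then have "(3 * (a + b)) ^ 3 \<le> (5 * b) ^ 3" by (rule power_mono) simp
    then have A: "27 * (a + b) ^ 3 \<le> 125 * b ^ 3" unfolding power_mult_distrib by simp
    have "9 * b ^ 3 \<le> 3 ^ i * 3 ^ j"
      using pow3_ge_9[of i] 5 assms by (intro mult_mono) auto
    then show ?thesis using A by (simp add: power_add)
  next
    case 6
    then have "3 * a \<le> a * b" "3 * b \<le> a * b" by auto
    from add_mono[OF this] have "3 * (a + b) \<le> 2 * (a * b)" by (simp add: algebra_simps)
    then have "(3 * (a + b)) ^ 3 \<le> (2 * (a * b)) ^ 3" by (rule power_mono) simp
    then have A: "27 * (a + b) ^ 3 \<le> 8 * (a ^ 3 * b ^ 3)" unfolding power_mult_distrib by simp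
    have "a ^ 3 * b ^ 3 \<le> 3 ^ i * 3 ^ j" using assms by (intro mult_mono) auto
    then show ?thesis using A by (simp add: power_add)
  qed
qed

text \<open>The gap \<open>8/9\<close> is attained at \<open>n = 2\<close>; it makes every nontrivial factor carry a definite
  share of the defect.\<close>

lemma eval_expr_gap:
  "eval_expr e ^ 3 \<le> 3 ^ ones e \<and> ((\<exists>j. eval_expr e = 3 ^ j) \<or> 9 * eval_expr e ^ 3 \<le> 8 * 3 ^ ones e)"
proof (induction e)
  case One
  then show ?case by (auto intro: exI[of _ 0])
next
  case (Plus a b)
  have *: "(eval_expr a + eval_expr b = 3 \<and> 3 ^ 3 \<le> (3::nat) ^ (ones a + ones b)) \<or>
     9 * (eval_expr a + eval_expr b) ^ 3 \<le> 8 * 3 ^ (ones a + ones b)"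
    using sum_cube_gap[of "eval_expr a" "eval_expr b" "ones a" "ones b"]
      sum_cube_gap[of "eval_expr b" "eval_expr a" "ones b" "ones a"] Plus
      eval_expr_pos ones_pos by (metis add.commute nat_le_linear)
  then show ?case by (auto intro: exI[of _ 1])
next
  case (Times a b)
  let ?u = "eval_expr a" and ?v = "eval_expr b"
  have 1: "?u ^ 3 * ?v ^ 3 \<le> 3 ^ ones a * 3 ^ ones b" using Times by (intro mult_mono) auto
  consider "\<exists>i j. ?u = 3 ^ i \<and> ?v = 3 ^ j" | "9 * ?u ^ 3 \<le> 8 * 3 ^ ones a" | "9 * ?v ^ 3 \<le> 8 * 3 ^ ones b"
    using Times by blast
  then show ?case
  proof cases
    case 1
    then have "\<exists>l. ?u * ?v = 3 ^ l" by (metis power_add)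
    then show ?thesis using \<open>?u ^ 3 * ?v ^ 3 \<le> _\<close>
      by (simp add: power_mult_distrib power_add)
  next
    case 2
    then have "(9 * ?u ^ 3) * ?v ^ 3 \<le> (8 * 3 ^ ones a) * 3 ^ ones b"
      using Times by (intro mult_le_mono[of "9 * ?u ^ 3"]) auto
    then show ?thesis using 1 by (simp add: power_mult_distrib power_add mult_ac)
  next
    case 3
    then have "?u ^ 3 * (9 * ?v ^ 3) \<le> 3 ^ ones a * (8 * 3 ^ ones b)"
      using Times by (intro mult_le_mono[of "?u ^ 3"]) auto
    then show ?thesis using 1 by (simp add: power_mult_distrib power_add mult_ac)
  qed
qed

section \<open>Attainment, subadditivity and optimal decompositions of the complexity\<close>

lemma expr_exists: "n > 0 \<Longrightarrow> \<exists>e. eval_expr e = n"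
proof (induction n)
  case (Suc n)
  show ?case
  proof (cases "n = 0")
    case True
    then show ?thesis by (intro exI[of _ One]) simp
  next
    case False
    then obtain e where "eval_expr e = n" using Suc by auto
    then show ?thesis by (intro exI[of _ "Plus e One"]) simp
  qed
qed simp

lemma cpx_attained: "n > 0 \<Longrightarrow> \<exists>e. eval_expr e = n \<and> ones e = cpx n"
  unfolding cpx_def by (rule LeastI_ex) (use expr_exists in blast)

lemma cpx_le_ones: "cpx (eval_expr e) \<le> ones e"
  unfolding cpx_def by (rule Least_le) blast

lemma cpx_pos: "n > 0 \<Longrightarrow> cpx n \<ge> 1"
  using cpx_attained ones_pos by metis

lemma cpx_1: "cpx 1 = 1"
  using cpx_le_ones[of One] cpx_pos[of 1] by simp

lemma cpx_3: "cpx 3 \<le> 3"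
  using cpx_le_ones[of "Plus (Plus One One) One"] by (simp add: numeral_3_eq_3)

lemma cpx_eq_1D: "n > 0 \<Longrightarrow> cpx n = 1 \<Longrightarrow> n = 1"
proof -
  assume "n > 0" "cpx n = 1"
  then obtain e where e: "eval_expr e = n" "ones e = 1" using cpx_attained by metis
  then show ?thesis
  proof (cases e)
    case (Plus a b) then show ?thesis using e ones_pos[of a] ones_pos[of b] by simp
  next
    case (Times a b) then show ?thesis using e ones_pos[of a] ones_pos[of b] by simp
  qed simp
qed

lemma cpx_add: "m > 0 \<Longrightarrow> n > 0 \<Longrightarrow> cpx (m + n) \<le> cpx m + cpx n"
  by (metis cpx_attained cpx_le_ones eval_expr.simps(2) ones.simps(2))

lemma cpx_mult: "m > 0 \<Longrightarrow> n > 0 \<Longrightarrow> cpx (m * n) \<le> cpx m + cpx n"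
  by (metis cpx_attained cpx_le_ones eval_expr.simps(3) ones.simps(3))

lemma cpx_pow3_mult: "n > 0 \<Longrightarrow> cpx (3 ^ k * n) \<le> cpx n + 3 * k"
proof (induction k)
  case (Suc k)
  have "cpx (3 * (3 ^ k * n)) \<le> cpx 3 + cpx (3 ^ k * n)" using Suc.prems by (intro cpx_mult) auto
  then show ?case using Suc cpx_3 by (simp add: mult.assoc)
qed simp

lemma cpx_cube: "n > 0 \<Longrightarrow> n ^ 3 \<le> 3 ^ cpx n"
  by (metis cpx_attained eval_expr_gap)

lemma cpx_gap: "n > 0 \<Longrightarrow> \<forall>j. n \<noteq> 3 ^ j \<Longrightarrow> 9 * n ^ 3 \<le> 8 * 3 ^ cpx n"
  by (metis cpx_attained eval_expr_gap)

lemma cpx_cases: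
  assumes "n > 0"
  obtains "n = 1"
  | a b where "a > 0" "b > 0" "n = a + b" "cpx n = cpx a + cpx b"
  | a b where "a > 0" "b > 0" "n = a * b" "cpx n = cpx a + cpx b"
proof -
  obtain e where e: "eval_expr e = n" "ones e = cpx n" using cpx_attained assms by metis
  show thesis
  proof (cases e)
    case One then show ?thesis using e that(1) by simp
  next
    case (Plus a b)
    have p: "eval_expr a > 0" "eval_expr b > 0" using eval_expr_pos[of a] eval_expr_pos[of b] by auto
    have "cpx n \<le> cpx (eval_expr a) + cpx (eval_expr b)" using cpx_add[OF p] Plus e by simp
    then show ?thesis using that(2)[OF p] Plus e cpx_le_ones[of a] cpx_le_ones[of b] by simp
  next
    case (Times a b)
    have p: "eval_expr a > 0" "eval_expr b > 0" using eval_expr_pos[of a] eval_expr_pos[of b] by auto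
    have "cpx n \<le> cpx (eval_expr a) + cpx (eval_expr b)" using cpx_mult[OF p] Times e by simp
    then show ?thesis using that(3)[OF p] Times e cpx_le_ones[of a] cpx_le_ones[of b] by simp
  qed
qed

section \<open>Stability and the stable complexity\<close>

lemma stable_exists:
  assumes "n > 0"
  shows "\<exists>a. stable (3 ^ a * n)"
proof -
  define f where "f a = cpx (3 ^ a * n)" for a
  have f0: "3 * a \<le> f a" for a
  proof -
    have "((3::nat) ^ a) ^ 3 \<le> (3 ^ a * n) ^ 3" using assms by (intro power_mono) auto
    also have "\<dots> \<le> 3 ^ f a" unfolding f_def using assms by (intro cpx_cube) auto
    finally have "(3::nat) ^ (3 * a) \<le> 3 ^ f a" by (simp add: power_mult[symmetric] mult.commute)
    then show ?thesis by (simp add: power_le_imp_le_exp)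
  qed
  \<comment> \<open>The cube bound \<open>f0\<close> keeps the truncated difference genuine. At its
    minimum no further factor \<open>3\<close> can be had for less than \<open>3\<close>.\<close>
  obtain a where a: "\<forall>b. f a - 3 * a \<le> f b - 3 * b"
    using ex_has_least_nat[of "\<lambda>_. True" 0 "\<lambda>a. f a - 3 * a"] by auto
  have "cpx (3 ^ k * (3 ^ a * n)) = cpx (3 ^ a * n) + 3 * k" for k
  proof (rule antisym)
    show "cpx (3 ^ k * (3 ^ a * n)) \<le> cpx (3 ^ a * n) + 3 * k" using assms by (intro cpx_pow3_mult) auto
    have "f a - 3 * a \<le> f (a + k) - 3 * (a + k)" using a by blast
    then show "cpx (3 ^ a * n) + 3 * k \<le> cpx (3 ^ k * (3 ^ a * n))"
      using f0[of a] f0[of "a + k"] unfolding f_def by (simp add: power_add mult_ac)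
  qed
  then show ?thesis unfolding stable_def by blast
qed

lemma stable_mult_pow3:
  assumes "stable n" shows "stable (3 ^ k * n)"
proof -
  have "cpx (3 ^ j * (3 ^ k * n)) = cpx n + 3 * (j + k)" for j
    using assms unfolding stable_def by (metis mult.assoc power_add)
  moreover have "cpx (3 ^ k * n) = cpx n + 3 * k" using assms unfolding stable_def by blast
  ultimately show ?thesis unfolding stable_def by simp
qed

text \<open>Any stabilising exponent exceeds the least one by some \<open>k\<close>, and from there
  on the complexity grows by exactly \<open>3 * k\<close>; hence the choice is immaterial.\<close>

lemma stable_cpx_eq:
  assumes "stable (3 ^ a * n)"
  shows "stable_cpx n = int (cpx (3 ^ a * n)) - 3 * int a"
proof -
  define b where "b = (LEAST a. stable (3 ^ a * n))"
  have b: "stable (3 ^ b * n)" unfolding b_def by (rule LeastI) (fact assms)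
  have "b \<le> a" unfolding b_def by (rule Least_le) (fact assms)
  then have "(3::nat) ^ a * n = 3 ^ (a - b) * (3 ^ b * n)"
    by (metis mult.assoc power_add le_add_diff_inverse2)
  then have "cpx (3 ^ a * n) = cpx (3 ^ b * n) + 3 * (a - b)" using b unfolding stable_def by metis
  then show ?thesis unfolding stable_cpx_def b_def[symmetric] Let_def using \<open>b \<le> a\<close> by simp
qed

lemma stable_cpx_eventually:
  assumes "n > 0"
  shows "eventually (\<lambda>a. stable (3 ^ a * n) \<and> stable_cpx n = int (cpx (3 ^ a * n)) - 3 * int a) sequentially"
proof -
  obtain a where a: "stable (3 ^ a * n)" using stable_exists assms by blast
  have "stable (3 ^ b * n)" if "b \<ge> a" for b
    using stable_mult_pow3[OF a, of "b - a"] that by (simp add: mult.assoc[symmetric] power_add[symmetric])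
  then show ?thesis using stable_cpx_eq unfolding eventually_sequentially by blast
qed

lemma stable_cpx_le: "n > 0 \<Longrightarrow> stable_cpx n \<le> int (cpx n)"
proof -
  assume n: "n > 0"
  then obtain a where "stable (3 ^ a * n)" using stable_exists by blast
  from stable_cpx_eq[OF this] cpx_pow3_mult[OF n, of a] show ?thesis by simp
qed

lemma stable_iff: "n > 0 \<Longrightarrow> stable n \<longleftrightarrow> stable_cpx n = int (cpx n)"
proof
  assume "stable n" then show "stable_cpx n = int (cpx n)" using stable_cpx_eq[of 0 n] by simp
next
  assume n: "n > 0" and eq: "stable_cpx n = int (cpx n)"
  have "cpx (3 ^ k * n) = cpx n + 3 * k" for k
  proof -
    obtain a where a: "stable (3 ^ a * (3 ^ k * n))" using stable_exists[of "3 ^ k * n"] n by auto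
    have "stable_cpx n = int (cpx (3 ^ a * (3 ^ k * n))) - 3 * int (a + k)"
      using stable_cpx_eq[of "a + k" n] a by (simp add: power_add mult_ac)
    moreover have "cpx (3 ^ a * (3 ^ k * n)) \<le> cpx (3 ^ k * n) + 3 * a" using n by (intro cpx_pow3_mult) auto
    moreover have "cpx (3 ^ k * n) \<le> cpx n + 3 * k" using n by (rule cpx_pow3_mult)
    ultimately show ?thesis using eq by simp
  qed
  then show "stable n" unfolding stable_def by blast
qed

lemma stable_cpx_pow3_mult:
  assumes "n > 0" shows "stable_cpx (3 ^ k * n) = stable_cpx n + 3 * int k"
proof -
  obtain a where a: "stable (3 ^ a * (3 ^ k * n))" using stable_exists[of "3 ^ k * n"] assms by auto
  then have "stable (3 ^ (a + k) * n)" by (simp add: power_add mult_ac)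
  from stable_cpx_eq[OF this] stable_cpx_eq[OF a] show ?thesis by (simp add: power_add mult_ac)
qed

lemma stable_cpx_mult:
  assumes "m > 0" "n > 0" shows "stable_cpx (m * n) \<le> stable_cpx m + stable_cpx n"
proof -
  obtain a b where a: "stable (3 ^ a * m)" and b: "stable (3 ^ b * n)" using stable_exists assms by blast
  have "stable_cpx (3 ^ (a + b) * (m * n)) \<le> int (cpx ((3 ^ a * m) * (3 ^ b * n)))"
    using stable_cpx_le[of "3 ^ (a + b) * (m * n)"] assms by (simp add: power_add mult_ac)
  also have "\<dots> \<le> int (cpx (3 ^ a * m) + cpx (3 ^ b * n))" using assms by (intro of_nat_mono cpx_mult) auto
  finally show ?thesis using stable_cpx_eq[OF a] stable_cpx_eq[OF b] assms
    by (subst (asm) stable_cpx_pow3_mult) auto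
qed

lemma stable_cpx_1: "stable_cpx 1 = 0"
proof -
  obtain a where a: "stable (3 ^ a * 1)" using stable_exists[of 1] by auto
  \<comment> \<open>The bound of \<open>3\<close> ones per factor \<open>3\<close> needs at least
    one factor, since \<open>cpx 1 = 1\<close>; so it is taken at \<open>Suc a\<close> and carried
    back by stability.\<close>
  have "cpx (3 ^ Suc a) \<le> 3 * Suc a"
    using cpx_pow3_mult[of 3 a] cpx_3 by (simp add: mult.commute)
  moreover have "cpx (3 ^ Suc a) = cpx (3 ^ a) + 3" using a[unfolded stable_def, rule_format, of 1] by simp
  moreover have "3 * a \<le> cpx (3 ^ a)"
    using cpx_cube[of "3 ^ a"] by (simp add: power_mult[symmetric] mult.commute power_le_imp_le_exp)
  ultimately show ?thesis using stable_cpx_eq[OF a] by simp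
qed

lemma stable_cpx_cube: "n > 0 \<Longrightarrow> real n ^ 3 \<le> 3 powr stable_cpx n"
proof -
  assume n: "n > 0"
  obtain a where a: "stable (3 ^ a * n)" using stable_exists n by blast
  have "real ((3 ^ a * n) ^ 3) \<le> real (3 ^ cpx (3 ^ a * n))" using n by (intro of_nat_mono cpx_cube) auto
  then have "3 ^ (3 * a) * real n ^ 3 \<le> 3 powr (cpx (3 ^ a * n))"
    by (simp add: power_mult_distrib power_mult[symmetric] mult.commute powr_realpow)
  also have "3 powr (cpx (3 ^ a * n)) = 3 powr (stable_cpx n) * 3 ^ (3 * a)"
    using stable_cpx_eq[OF a] by (simp add: powr_realpow[symmetric] powr_add[symmetric])
  finally show ?thesis by simp
qed

lemma stable_cpx_gap:
  assumes n: "n > 0" "\<forall>j. n \<noteq> 3 ^ j"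
  shows "9 * real n ^ 3 \<le> 8 * 3 powr stable_cpx n"
proof -
  obtain a where a: "stable (3 ^ a * n)" using stable_exists n by blast
  have np: "3 ^ a * n \<noteq> 3 ^ j" for j
  proof
    assume eq: "3 ^ a * n = 3 ^ j"
    then have "n dvd 3 ^ j" by (metis dvd_triv_right)
    moreover have "prime (3::nat)" by simp
    ultimately obtain i where "n = 3 ^ i" using divides_primepow_nat by blast
    then show False using n by blast
  qed
  have "real (9 * (3 ^ a * n) ^ 3) \<le> real (8 * 3 ^ cpx (3 ^ a * n))"
    using n np by (intro of_nat_mono cpx_gap) auto
  then have "9 * (3 ^ (3 * a) * real n ^ 3) \<le> 8 * 3 powr (cpx (3 ^ a * n))"
    by (simp add: power_mult_distrib power_mult[symmetric] mult.commute powr_realpow)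
  also have "3 powr (cpx (3 ^ a * n)) = 3 powr (stable_cpx n) * 3 ^ (3 * a)"
    using stable_cpx_eq[OF a] by (simp add: powr_realpow[symmetric] powr_add[symmetric])
  finally show ?thesis by simp
qed

lemma stable_cpx_nonneg:
  assumes "n > 0" shows "stable_cpx n \<ge> 0"
proof -
  have "1 \<le> real n ^ 3" using assms by (intro one_le_power) auto
  also have "\<dots> \<le> 3 powr stable_cpx n" using assms by (rule stable_cpx_cube)
  finally show ?thesis by (smt (verit) of_int_less_0_iff powr_less_one)
qed

text \<open>The equality case: \<open>cpx a + cpx b = stable_cpx (a * b)\<close> is squeezed from
  below by \<open>stable_cpx a + stable_cpx b\<close>, so every inequality in between is an
  equality.\<close>

lemma stable_mult_cases:
  assumes "a > 0" "b > 0" "stable (a * b)" "cpx (a * b) = cpx a + cpx b"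
  shows "stable a" "stable b" "stable_cpx (a * b) = stable_cpx a + stable_cpx b"
  using assms stable_cpx_mult[of a b] stable_cpx_le[of a] stable_cpx_le[of b]
  by (auto simp: stable_iff)

section \<open>Complexity on the positive ternary rationals\<close>

definition tern :: "real set" where
  "tern = {real n / 3 ^ k | n k. n > 0}"

text \<open>Well defined because \<open>stable_cpx (3 ^ k * n) = stable_cpx n + 3 * k\<close>; the
  plain complexity would not descend to fractions.\<close>

definition tcpx :: "real \<Rightarrow> int" where
  "tcpx x = (THE v. \<exists>n k. n > 0 \<and> x = real n / 3 ^ k \<and> v = stable_cpx n - 3 * int k)"

lemma tcpx_eq:
  assumes "n > 0" shows "tcpx (real n / 3 ^ k) = stable_cpx n - 3 * int k"
  unfolding tcpx_def
proof (rule the_equality)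
  show "\<exists>n' k'. n' > 0 \<and> real n / 3 ^ k = real n' / 3 ^ k' \<and>
      stable_cpx n - 3 * int k = stable_cpx n' - 3 * int k'"
    using assms by blast
next
  fix v assume "\<exists>n' k'. n' > 0 \<and> real n / 3 ^ k = real n' / 3 ^ k' \<and> v = stable_cpx n' - 3 * int k'"
  then obtain n' k' where *: "n' > 0" "real n / 3 ^ k = real n' / 3 ^ k'" "v = stable_cpx n' - 3 * int k'"
    by blast
  then have "real (3 ^ k' * n) = real (3 ^ k * n')" by (simp add: field_simps)
  then have "3 ^ k' * n = 3 ^ k * n'" by (simp only: of_nat_eq_iff)
  then have "stable_cpx n + 3 * int k' = stable_cpx n' + 3 * int k"
    using stable_cpx_pow3_mult[of n k'] stable_cpx_pow3_mult[of n' k] assms * by simp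
  then show "v = stable_cpx n - 3 * int k" using * by simp
qed

lemma ternE:
  assumes "x \<in> tern"
  obtains n k where "n > 0" "x = real n / 3 ^ k" "tcpx x = stable_cpx n - 3 * int k"
  using assms tcpx_eq unfolding tern_def by blast

lemma tern_frac: "n > 0 \<Longrightarrow> real n / 3 ^ k \<in> tern"
  unfolding tern_def by blast

lemma tern_pos: "x \<in> tern \<Longrightarrow> x > 0"
  by (auto simp: tern_def)

lemma tern_of_nat: "n > 0 \<Longrightarrow> real n \<in> tern" and tcpx_of_nat: "n > 0 \<Longrightarrow> tcpx (real n) = stable_cpx n"
  using tern_frac[of n 0] tcpx_eq[of n 0] by auto

lemma tern_mult: assumes "x \<in> tern" "y \<in> tern" shows "x * y \<in> tern" "tcpx (x * y) \<le> tcpx x + tcpx y"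
proof -
  obtain m j where x: "m > 0" "x = real m / 3 ^ j" "tcpx x = stable_cpx m - 3 * int j"
    using assms(1) by (rule ternE)
  obtain n k where y: "n > 0" "y = real n / 3 ^ k" "tcpx y = stable_cpx n - 3 * int k"
    using assms(2) by (rule ternE)
  have xy: "x * y = real (m * n) / 3 ^ (j + k)" using x y by (simp add: power_add)
  show "x * y \<in> tern" unfolding xy using x y by (intro tern_frac) auto
  have "tcpx (x * y) = stable_cpx (m * n) - 3 * int (j + k)"
    unfolding xy using x y by (intro tcpx_eq) auto
  then show "tcpx (x * y) \<le> tcpx x + tcpx y" using stable_cpx_mult[of m n] x y by simp
qed

lemma tern_scale:
  assumes "x \<in> tern" shows "x * 3 powi j \<in> tern" "tcpx (x * 3 powi j) = tcpx x + 3 * j"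
proof -
  obtain n k where x: "n > 0" "x = real n / 3 ^ k" "tcpx x = stable_cpx n - 3 * int k"
    using assms(1) by (rule ternE)
  have "x * 3 powi j \<in> tern \<and> tcpx (x * 3 powi j) = tcpx x + 3 * j"
  proof (cases "j \<ge> 0")
    case True
    then have *: "x * 3 powi j = real (3 ^ nat j * n) / 3 ^ k" using x by (simp add: power_int_def)
    have "x * 3 powi j \<in> tern" unfolding * using x by (intro tern_frac) auto
    moreover have "tcpx (x * 3 powi j) = stable_cpx (3 ^ nat j * n) - 3 * int k"
      unfolding * using x by (intro tcpx_eq) auto
    ultimately show ?thesis
      using stable_cpx_pow3_mult[of n "nat j"] x True by simp
  next
    case False
    then have *: "x * 3 powi j = real n / 3 ^ (k + nat (- j))"
      using x by (simp add: power_int_def power_add field_simps)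
    have "x * 3 powi j \<in> tern" unfolding * using x by (intro tern_frac) auto
    moreover have "tcpx (x * 3 powi j) = tcpx x + 3 * j"
      unfolding * using x False by (subst tcpx_eq) auto
    ultimately show ?thesis by blast
  qed
  then show "x * 3 powi j \<in> tern" "tcpx (x * 3 powi j) = tcpx x + 3 * j" by auto
qed

lemma tern_1: "1 \<in> tern" and tcpx_1: "tcpx 1 = 0"
  using tern_of_nat[of 1] tcpx_of_nat[of 1] stable_cpx_1 by auto

lemma tern_powi: "3 powi j \<in> tern" and tcpx_powi: "tcpx (3 powi j) = 3 * j"
  using tern_scale[OF tern_1, of j] tcpx_1 by auto

lemma tcpx_cube_scale: "3 powr (of_int (stable_cpx n - 3 * int k)) = 3 powr stable_cpx n / (3 ^ k) ^ 3"
proof -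
  have "(3::real) powr (3 * real k) = (3 ^ k) ^ 3"
    using powr_realpow[of 3 "3 * k"] by (simp add: power_mult[symmetric] mult.commute)
  then show ?thesis by (simp add: powr_diff)
qed

lemma tcpx_cube: assumes "x \<in> tern" shows "x ^ 3 \<le> 3 powr tcpx x"
proof -
  obtain n k where x: "n > 0" "x = real n / 3 ^ k" "tcpx x = stable_cpx n - 3 * int k"
    using assms(1) by (rule ternE)
  show ?thesis unfolding x(3) tcpx_cube_scale unfolding x(2) power_divide
    using stable_cpx_cube[OF x(1)] by (simp add: divide_right_mono)
qed

lemma tcpx_gap:
  assumes "x \<in> tern" "\<forall>j. x \<noteq> 3 powi j" shows "9 * x ^ 3 \<le> 8 * 3 powr tcpx x"
proof -
  obtain n k where x: "n > 0" "x = real n / 3 ^ k" "tcpx x = stable_cpx n - 3 * int k"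
    using assms(1) by (rule ternE)
  have "n \<noteq> 3 ^ i" for i
  proof
    assume "n = 3 ^ i"
    then have "x = 3 powi (int i - int k)" using x by (simp add: power_int_diff)
    then show False using assms by blast
  qed
  from stable_cpx_gap[OF x(1)] this
  have "(9 * real n ^ 3) / (3 ^ k) ^ 3 \<le> (8 * 3 powr stable_cpx n) / (3 ^ k) ^ 3"
    by (intro divide_right_mono) auto
  then show ?thesis unfolding x(3) tcpx_cube_scale unfolding x(2) power_divide by simp
qed

text \<open>Once \<open>3 ^ a * n\<close> is stable, its complexity is the stable one up to
  \<open>3 * a\<close>, and \<open>+ 1\<close> costs one more. Before that point the plain
  complexity may be too large, hence only eventually.\<close>

lemma tern_add_small:
  assumes "x \<in> tern"
  shows "eventually (\<lambda>r. x + 1 / 3 ^ r \<in> tern \<and> tcpx (x + 1 / 3 ^ r) \<le> tcpx x + 1) sequentially"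
proof -
  obtain n k where x: "n > 0" "x = real n / 3 ^ k" "tcpx x = stable_cpx n - 3 * int k"
    using assms(1) by (rule ternE)
  obtain R where R: "\<And>a. a \<ge> R \<Longrightarrow> stable_cpx n = int (cpx (3 ^ a * n)) - 3 * int a"
    using stable_cpx_eventually[OF x(1)] unfolding eventually_sequentially by blast
  have "x + 1 / 3 ^ r \<in> tern \<and> tcpx (x + 1 / 3 ^ r) \<le> tcpx x + 1" if r: "r \<ge> R + k" for r
  proof -
    obtain a where a: "r = a + k" using r by (metis add_leE le_add_diff_inverse2)
    have *: "x + 1 / 3 ^ r = real (3 ^ a * n + 1) / 3 ^ r"
      using x a by (simp add: power_add field_simps)
    have "stable_cpx (3 ^ a * n + 1) \<le> int (cpx (3 ^ a * n + 1))" by (rule stable_cpx_le) simp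
    also have "\<dots> \<le> int (cpx (3 ^ a * n) + cpx 1)" using x by (intro of_nat_mono cpx_add) auto
    also have "\<dots> = stable_cpx n + 3 * int a + 1" using R[of a] a r cpx_1 by simp
    finally have "tcpx (x + 1 / 3 ^ r) \<le> tcpx x + 1"
      unfolding * using x a by (subst tcpx_eq) auto
    moreover have "x + 1 / 3 ^ r \<in> tern" unfolding * by (rule tern_frac) simp
    ultimately show ?thesis by blast
  qed
  then show ?thesis unfolding eventually_sequentially by blast
qed

section \<open>Optimal factorisations and decompositions\<close>

definition good_factor :: "real \<Rightarrow> real \<Rightarrow> real \<Rightarrow> bool" where
  "good_factor x y z \<longleftrightarrow> y \<in> tern \<and> z \<in> tern \<and> x = y * z \<and> tcpx x = tcpx y + tcpx z"

text \<open>An optimal product with a power of \<open>3\<close> as a factor gives no progress, so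
  such factors are stripped by strong induction until a sum or a product of two non-powers remains.
  The exponent \<open>k\<close> is an integer because stripped powers multiply the sum. The sum case
  keeps ordinary complexities, as the summands need not be stable.\<close>

lemma stable_decompose:
  assumes "m > 0" "stable m" "\<forall>j. m \<noteq> 3 ^ j"
  shows "(\<exists>y z. (\<forall>j. y \<noteq> 3 powi j) \<and> (\<forall>j. z \<noteq> 3 powi j) \<and> good_factor (real m) y z) \<or>
    (\<exists>a b k. 0 < b \<and> b \<le> a \<and> real m = real (a + b) / 3 powi k \<and>
      int (cpx a + cpx b) = tcpx (real m) + 3 * k)"
  using assms
proof (induction m rule: less_induct)
  case (less m)
  have tm: "tcpx (real m) = int (cpx m)" using less.prems tcpx_of_nat stable_iff by simp
  have not_powi: "real u \<noteq> 3 powi j" if "u > 0" "\<forall>i. u \<noteq> 3 ^ i" for u j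
  proof
    assume eq: "real u = 3 powi j"
    show False
    proof (cases "j \<ge> 0")
      case True
      then have "real u = real (3 ^ nat j)" using eq by (simp add: power_int_def)
      then show False using that by (metis of_nat_eq_iff)
    next
      case False
      then have "(3::real) powi j < 1" by (simp add: power_int_def power_less_one_iff inverse_less_1_iff)
      then show False using eq that by simp
    qed
  qed
  have reduce: ?case if "u = 3 ^ i" "v > 0" "m = u * v" "cpx m = cpx u + cpx v" for u v i
  proof -
    have u: "u > 0" using that by simp
    have st: "stable u" "stable v" "stable_cpx m = stable_cpx u + stable_cpx v"
      using stable_mult_cases[OF u that(2)] that less.prems by auto
    \<comment> \<open>The factor \<open>1\<close> cannot occur: factors of a stable optimal product
      are stable, and \<open>1\<close> is not. This makes the recursion descend.\<close>
    have "i \<noteq> 0"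
    proof
      assume "i = 0"
      then show False using st(1) that stable_iff[of 1] stable_cpx_1 cpx_1 by simp
    qed
    have "u > 1" using \<open>i \<noteq> 0\<close> that one_less_power[of "3::nat" i] by simp
    then have "v < m" using that by simp
    have "\<forall>j. v \<noteq> 3 ^ j" using less.prems(3) that by (metis power_add)
    from less.IH[OF \<open>v < m\<close> that(2) st(2) this]
    show ?thesis
    proof
      assume "\<exists>y z. (\<forall>j. y \<noteq> 3 powi j) \<and> (\<forall>j. z \<noteq> 3 powi j) \<and> good_factor (real v) y z"
      then obtain y z where yz: "\<forall>j. y \<noteq> 3 powi j" "\<forall>j. z \<noteq> 3 powi j" "good_factor (real v) y z" by blast
      have "y * 3 powi (int i) \<noteq> 3 powi j" for j
      proof
        assume "y * 3 powi (int i) = 3 powi j"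
        then have "y = 3 powi (j - int i)" by (simp add: power_int_diff field_simps)
        then show False using yz by blast
      qed
      moreover have "good_factor (real m) (y * 3 powi (int i)) z"
        using yz(3) tern_scale[of y "int i"] tern_scale[of "real v" "int i"] tern_of_nat[of v] that
        unfolding good_factor_def by (auto simp: mult_ac)
      ultimately show ?thesis using yz by blast
    next
      assume "\<exists>a b k. 0 < b \<and> b \<le> a \<and> real v = real (a + b) / 3 powi k \<and>
        int (cpx a + cpx b) = tcpx (real v) + 3 * k"
      then obtain a b k where ab: "0 < b" "b \<le> a" "real v = real (a + b) / 3 powi k"
        "int (cpx a + cpx b) = tcpx (real v) + 3 * k" by blast
      have "real m = real (a + b) / 3 powi (k - int i)"
        unfolding \<open>m = u * v\<close> of_nat_mult ab(3) using that by (simp add: power_int_diff)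
      moreover have "int (cpx a + cpx b) = tcpx (real m) + 3 * (k - int i)"
        using ab(4) tern_scale[of "real v" "int i"] tern_of_nat[of v] that by (simp add: mult_ac)
      ultimately show ?thesis using ab by blast
    qed
  qed
  from less.prems(1) show ?case
  proof (cases rule: cpx_cases)
    case 1 then show ?thesis using less.prems(3)[rule_format, of 0] by simp
  next
    case (2 a b)
    have "\<exists>a b. 0 < b \<and> b \<le> a \<and> m = a + b \<and> cpx m = cpx a + cpx b"
      using 2 by (metis add.commute nat_le_linear)
    then obtain a b where "0 < b" "b \<le> a" "m = a + b" "cpx m = cpx a + cpx b" by blast
    then have "0 < b \<and> b \<le> a \<and> real m = real (a + b) / 3 powi 0 \<and>
        int (cpx a + cpx b) = tcpx (real m) + 3 * 0" using tm by simp
    then show ?thesis by blast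
  next
    case (3 u v)
    consider i where "u = 3 ^ i" | i where "v = 3 ^ i" | "\<forall>i. u \<noteq> 3 ^ i" "\<forall>i. v \<noteq> 3 ^ i" by blast
    then show ?thesis
    proof cases
      case 1 show ?thesis using reduce[OF 1] 3 by simp
    next
      case 2 show ?thesis using reduce[OF 2, of u] 3 by (simp add: mult.commute)
    next
      case c: 3
      have "stable_cpx m = stable_cpx u + stable_cpx v"
        using stable_mult_cases[of u v] 3 less.prems by auto
      then have "good_factor (real m) (real u) (real v)" unfolding good_factor_def
        using 3 tern_of_nat tcpx_of_nat[of u] tcpx_of_nat[of v] tcpx_of_nat[of m] less.prems(1) by simp
      then show ?thesis using not_powi c 3 by blast
    qed
  qed
qed

lemma tern_decompose:
  assumes "x \<in> tern" "\<forall>j. x \<noteq> 3 powi j"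
  shows "(\<exists>y z. (\<forall>j. y \<noteq> 3 powi j) \<and> (\<forall>j. z \<noteq> 3 powi j) \<and> good_factor x y z) \<or>
    (\<exists>a b k. 0 < b \<and> b \<le> a \<and> x = real (a + b) / 3 powi k \<and>
      int (cpx a + cpx b) = tcpx x + 3 * k)"
proof -
  obtain n k where x: "n > 0" "x = real n / 3 ^ k" "tcpx x = stable_cpx n - 3 * int k"
    using assms(1) by (rule ternE)
  obtain i where i: "stable (3 ^ i * n)" using stable_exists x by blast
  define m where "m = 3 ^ i * n"
  define l where "l = int k + int i"
  have xm: "x = real m / 3 powi l" and mx: "real m = x * 3 powi l"
    using x unfolding m_def l_def by (simp_all add: power_int_add)
  have m: "m > 0" "stable m" using i x unfolding m_def by auto
  have tx: "tcpx (real m) = tcpx x + 3 * l" unfolding mx using assms(1) by (rule tern_scale)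
  have "m \<noteq> 3 ^ j" for j
  proof
    assume "m = 3 ^ j"
    then have "x = 3 powi (int j - l)" using xm by (simp add: power_int_diff)
    then show False using assms by blast
  qed
  then have "\<forall>j. m \<noteq> 3 ^ j" by blast
  from stable_decompose[OF m this] show ?thesis
  proof
    assume "\<exists>y z. (\<forall>j. y \<noteq> 3 powi j) \<and> (\<forall>j. z \<noteq> 3 powi j) \<and> good_factor (real m) y z"
    then obtain y z where yz: "\<forall>j. y \<noteq> 3 powi j" "\<forall>j. z \<noteq> 3 powi j" "good_factor (real m) y z" by blast
    have "y * 3 powi (- l) \<noteq> 3 powi j" for j
    proof
      assume "y * 3 powi (- l) = 3 powi j"
      then have "y = 3 powi (j + l)" by (simp add: power_int_add power_int_minus field_simps)
      then show False using yz by blast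
    qed
    moreover have "good_factor x (y * 3 powi (- l)) z"
      unfolding good_factor_def
    proof (intro conjI)
      have y: "y \<in> tern" "real m = y * z" "tcpx (real m) = tcpx y + tcpx z"
        using yz(3) unfolding good_factor_def by auto
      show "y * 3 powi (- l) \<in> tern" "z \<in> tern"
        using yz(3) tern_scale[of y "- l"] unfolding good_factor_def by auto
      show "x = y * 3 powi (- l) * z" unfolding xm y(2) by (simp add: power_int_minus field_simps)
      show "tcpx x = tcpx (y * 3 powi (- l)) + tcpx z"
        using tern_scale(2)[OF y(1), of "- l"] y(3) tx by simp
    qed
    ultimately show ?thesis using yz by blast
  next
    assume "\<exists>a b k. 0 < b \<and> b \<le> a \<and> real m = real (a + b) / 3 powi k \<and>
        int (cpx a + cpx b) = tcpx (real m) + 3 * k"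
    then obtain a b k where ab: "0 < b" "b \<le> a" "real m = real (a + b) / 3 powi k"
        "int (cpx a + cpx b) = tcpx (real m) + 3 * k" by blast
    have "x = real (a + b) / 3 powi (k + l)" using xm ab(3) by (simp add: power_int_add)
    moreover have "int (cpx a + cpx b) = tcpx x + 3 * (k + l)" using ab(4) tx by simp
    ultimately show ?thesis using ab by blast
  qed
qed

section \<open>Sequences of bounded complexity\<close>

text \<open>\<open>settled c X\<close> is the dichotomy that passing to a subsequence achieves for sequences with
  \<open>tcpx (X n) \<le> c\<close> that stay away from \<open>0\<close>; the last alternative is the shape prescribed by the
  definition of an arithmetic compact set.\<close>

definition settled :: "int \<Rightarrow> (nat \<Rightarrow> real) \<Rightarrow> bool" where
  "settled c X \<longleftrightarrow> (\<exists>x. \<forall>n. X n = x) \<or>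
     (\<exists>x\<in>tern. X \<longlonglongrightarrow> x \<and> (\<forall>n. X n > x) \<and>
        (tcpx x \<le> c - 2 \<or>
         tcpx x = c - 1 \<and> (\<exists>\<alpha> \<beta>. good_factor x \<alpha> \<beta> \<and> (\<forall>n. \<exists>r::int. X n = \<beta> * (\<alpha> + 3 powi r)))))"

lemma settled_limI:
  assumes "x \<in> tern" "X \<longlonglongrightarrow> x" "\<forall>n. X n > x"
    "tcpx x \<le> c - 2 \<or> tcpx x = c - 1 \<and>
      (\<exists>\<alpha> \<beta>. good_factor x \<alpha> \<beta> \<and> (\<forall>n. \<exists>r::int. X n = \<beta> * (\<alpha> + 3 powi r)))"
  shows "settled c X"
  unfolding settled_def by (rule disjI2, rule bexI[of _ x], intro conjI, fact+)

lemma settled_subseq: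
  fixes X :: "nat \<Rightarrow> real" and \<phi> :: "nat \<Rightarrow> nat"
  assumes "settled c X" "strict_mono \<phi>" shows "settled c (X \<circ> \<phi>)"
  using assms(1) unfolding settled_def
proof (elim disjE)
  assume "\<exists>x\<in>tern. X \<longlonglongrightarrow> x \<and> (\<forall>n. X n > x) \<and>
        (tcpx x \<le> c - 2 \<or>
         tcpx x = c - 1 \<and> (\<exists>\<alpha> \<beta>. good_factor x \<alpha> \<beta> \<and> (\<forall>n. \<exists>r::int. X n = \<beta> * (\<alpha> + 3 powi r))))"
  then obtain x where x: "x \<in> tern" "X \<longlonglongrightarrow> x" "\<forall>n. X n > x" "(tcpx x \<le> c - 2 \<or>
         tcpx x = c - 1 \<and> (\<exists>\<alpha> \<beta>. good_factor x \<alpha> \<beta> \<and> (\<forall>n. \<exists>r::int. X n = \<beta> * (\<alpha> + 3 powi r))))"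
    by blast
  have "(X \<circ> \<phi>) \<longlonglongrightarrow> x" using x(2) assms(2) by (rule LIMSEQ_subseq_LIMSEQ)
  moreover have "tcpx x \<le> c - 2 \<or> tcpx x = c - 1 \<and>
      (\<exists>\<alpha> \<beta>. good_factor x \<alpha> \<beta> \<and> (\<forall>n. \<exists>r::int. (X \<circ> \<phi>) n = \<beta> * (\<alpha> + 3 powi r)))"
    using x(4) by fastforce
  ultimately show "(\<exists>x. \<forall>n. (X \<circ> \<phi>) n = x) \<or> (\<exists>x\<in>tern. (X \<circ> \<phi>) \<longlonglongrightarrow> x \<and> (\<forall>n. (X \<circ> \<phi>) n > x) \<and>
        (tcpx x \<le> c - 2 \<or> tcpx x = c - 1 \<and>
          (\<exists>\<alpha> \<beta>. good_factor x \<alpha> \<beta> \<and> (\<forall>n. \<exists>r::int. (X \<circ> \<phi>) n = \<beta> * (\<alpha> + 3 powi r)))))"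
    using x(1,3) unfolding o_def by blast
qed auto

text \<open>The constant is absorbed into \<open>\<beta>\<close>. If the new limit loses exactly
  one, subadditivity holds with equality throughout, so \<open>\<alpha>\<close> and
  \<open>\<beta> * t\<close> form an optimal factorisation of the new limit.\<close>

lemma settled_mult_const:
  assumes "settled c X" "t \<in> tern" "tcpx t \<le> d"
  shows "settled (c + d) (\<lambda>n. X n * t)"
  using assms(1) unfolding settled_def[of c]
proof (elim disjE bexE)
  fix x assume x: "x \<in> tern" and *: "X \<longlonglongrightarrow> x \<and> (\<forall>n. X n > x) \<and>
        (tcpx x \<le> c - 2 \<or>
         tcpx x = c - 1 \<and> (\<exists>\<alpha> \<beta>. good_factor x \<alpha> \<beta> \<and> (\<forall>n. \<exists>r::int. X n = \<beta> * (\<alpha> + 3 powi r))))"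
  have le: "tcpx (x * t) \<le> tcpx x + d" using tern_mult(2)[OF x assms(2)] assms(3) by simp
  have "tcpx (x * t) \<le> c + d - 2 \<or> tcpx (x * t) = c + d - 1 \<and>
      (\<exists>\<alpha> \<beta>. good_factor (x * t) \<alpha> \<beta> \<and> (\<forall>n. \<exists>r::int. X n * t = \<beta> * (\<alpha> + 3 powi r)))"
  proof (cases "tcpx x \<le> c - 2 \<or> tcpx (x * t) \<le> c + d - 2")
    case True then show ?thesis using le by linarith
  next
    case False
    then obtain \<alpha> \<beta> where ab: "good_factor x \<alpha> \<beta>" "\<forall>n. \<exists>r::int. X n = \<beta> * (\<alpha> + 3 powi r)"
      and tx: "tcpx x = c - 1" using * by blast
    have f: "\<alpha> \<in> tern" "\<beta> \<in> tern" "x = \<alpha> * \<beta>" "tcpx x = tcpx \<alpha> + tcpx \<beta>"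
      using ab unfolding good_factor_def by auto
    have eq: "tcpx (x * t) = c + d - 1" using le False tx by linarith
    have bt: "\<beta> * t \<in> tern" "tcpx (\<beta> * t) \<le> tcpx \<beta> + tcpx t" using tern_mult f(2) assms(2) by auto
    have xt: "x * t = \<alpha> * (\<beta> * t)" using f by simp
    have "tcpx (x * t) \<le> tcpx \<alpha> + tcpx (\<beta> * t)" unfolding xt using tern_mult(2)[OF f(1) bt(1)] .
    then have "tcpx (x * t) = tcpx \<alpha> + tcpx (\<beta> * t)" using f(4) bt(2) eq tx assms(3) by linarith
    then have "good_factor (x * t) \<alpha> (\<beta> * t)"
      unfolding good_factor_def using f(1) bt(1) xt by blast
    moreover have "\<exists>r::int. X n * t = \<beta> * t * (\<alpha> + 3 powi r)" for n
      using ab(2)[rule_format, of n] by (auto simp: mult_ac)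
    ultimately show ?thesis using eq by blast
  qed
  moreover have "(\<lambda>n. X n * t) \<longlonglongrightarrow> x * t" using * by (intro tendsto_intros) auto
  moreover have "\<forall>n. X n * t > x * t" using * tern_pos[OF assms(2)] by simp
  ultimately show ?thesis using settled_limI[OF tern_mult(1)[OF x assms(2)]] by blast
qed (auto simp: settled_def)

lemma settled_cases:
  assumes "settled c X"
  obtains x where "\<forall>n. X n = x"
  | x where "x \<in> tern" "X \<longlonglongrightarrow> x" "\<forall>n. X n > x" "tcpx x \<le> c - 1"
proof -
  from assms consider x where "\<forall>n. X n = x"
    | x where "x \<in> tern" "X \<longlonglongrightarrow> x" "\<forall>n. X n > x" "tcpx x \<le> c - 2 \<or> tcpx x = c - 1"
    unfolding settled_def by blast
  then show thesis
  proof cases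
    case 1 then show ?thesis by (rule that(1))
  next
    case (2 x) then show ?thesis by (intro that(2)[of x]) auto
  qed
qed

text \<open>If neither sequence is constant, each limit loses one, so the product loses two and no
  shape has to be tracked. Otherwise one factor is a constant.\<close>

lemma settled_mult:
  assumes "settled c X" "settled d Y" "\<And>n. X n \<in> tern" "\<And>n. tcpx (X n) \<le> c"
    "\<And>n. Y n \<in> tern" "\<And>n. tcpx (Y n) \<le> d"
  shows "settled (c + d) (\<lambda>n. X n * Y n)"
proof -
  consider y where "\<forall>n. Y n = y" | x where "\<forall>n. X n = x"
    | x y where "x \<in> tern" "X \<longlonglongrightarrow> x" "\<forall>n. X n > x" "tcpx x \<le> c - 1"
        "y \<in> tern" "Y \<longlonglongrightarrow> y" "\<forall>n. Y n > y" "tcpx y \<le> d - 1"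
    by (rule settled_cases[OF assms(1)]; rule settled_cases[OF assms(2)]) blast+
  then show ?thesis
  proof cases
    case 1
    then show ?thesis using settled_mult_const[OF assms(1), of y d] assms(5,6)[of 0] by simp
  next
    case 2
    then show ?thesis using settled_mult_const[OF assms(2), of x c] assms(3,4)[of 0]
      by (simp add: mult.commute add.commute)
  next
    case 3
    have "(\<lambda>n. X n * Y n) \<longlonglongrightarrow> x * y" using 3 by (intro tendsto_intros) auto
    moreover have "X n * Y n > x * y" for n
      using 3(3,7) tern_pos[OF 3(1)] tern_pos[OF 3(5)] by (intro mult_strict_mono) (auto intro: less_imp_le less_trans)
    moreover have "tcpx (x * y) \<le> c + d - 2" using tern_mult(2)[OF 3(1,5)] 3(4,8) by simp
    ultimately show ?thesis using settled_limI[OF tern_mult(1)[OF 3(1,5)]] by blast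
  qed
qed

section \<open>Choosing subsequences; powers of three\<close>

lemma finite_range_const_subseq:
  fixes X :: "nat \<Rightarrow> 'a"
  assumes "finite (range X)"
  shows "\<exists>\<phi> x. strict_mono \<phi> \<and> (\<forall>n::nat. X (\<phi> n) = x)"
proof -
  obtain a where "infinite {n. X n = X a}" using pigeonhole_infinite[of UNIV X] assms by auto
  from infinite_enumerate[OF this] show ?thesis by auto
qed

text \<open>Meant for the exponents of the denominators: a constant exponent leaves finitely many
  values, while \<open>n \<le> f (\<phi> n)\<close> makes a fixed numerator decay at least like
  \<open>1 / 3 ^ n\<close>.\<close>

lemma nat_seq_const_or_strict_mono_subseq:
  fixes f :: "nat \<Rightarrow> nat"
  shows "\<exists>\<phi>. strict_mono (\<phi> :: nat \<Rightarrow> nat) \<and> ((\<exists>k. \<forall>n. f (\<phi> n) = k) \<or> (\<forall>n. n \<le> f (\<phi> n)))"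
proof (cases "finite (range f)")
  case True
  then show ?thesis using finite_range_const_subseq[of f] by blast
next
  case False
  have "\<exists>m>n. k \<le> f m" for n k :: nat
  proof (rule ccontr)
    assume "\<not> ?thesis"
    then have "f m \<in> f ` {..n} \<union> {..k}" for m by (cases "m \<le> n") (auto simp: not_le less_imp_le)
    then have "range f \<subseteq> f ` {..n} \<union> {..k}" by blast
    then show False using False finite_subset by blast
  qed
  then have "\<exists>\<phi>. \<forall>n. (n \<le> f (\<phi> n)) \<and> \<phi> n < \<phi> (Suc n)"
    by (intro dependent_nat_choice) blast+
  then show ?thesis by (metis strict_mono_Suc_iff)
qed

lemma powi_seq_finite:
  assumes "\<And>n. 3 * j n \<le> c" "\<And>n. c \<le> 3 * j n + int N"
  shows "finite (range (\<lambda>n. (3::real) powi j n))"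
proof -
  have "- \<bar>c\<bar> - int N \<le> j n \<and> j n \<le> \<bar>c\<bar>" for n using assms[of n] by linarith
  then have "range j \<subseteq> {- \<bar>c\<bar> - int N .. \<bar>c\<bar>}" by auto
  then have "finite (range j)" by (rule finite_subset) simp
  then have "finite ((powi) (3::real) ` range j)" by blast
  then show ?thesis by (simp add: image_image)
qed

text \<open>The complexity of a power of \<open>3\<close> is \<open>3 * j n\<close>, and the defect
  bound limits how far it lies below \<open>c\<close>; only finitely many powers remain.\<close>

lemma settled_powi:
  fixes X :: "nat \<Rightarrow> real"
  assumes "\<And>n. X n = 3 powi j n" "\<And>n. tcpx (X n) \<le> c" "\<And>n. 3 powr c \<le> X n ^ 3 * (9/8) ^ N"
  shows "\<exists>\<phi>::nat \<Rightarrow> nat. strict_mono \<phi> \<and> settled c (X \<circ> \<phi>)"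
proof -
  have "c \<le> 3 * j n + int N" for n
  proof -
    \<comment> \<open>A crude replacement that turns the defect bound into an exponent of base
      \<open>3\<close>.\<close>
    have "(9/8::real) ^ N \<le> 3 ^ N" by (intro power_mono) auto
    then have "X n ^ 3 * (9/8) ^ N \<le> X n ^ 3 * 3 ^ N" using assms(1)[of n] by (intro mult_left_mono) auto
    also have "\<dots> = 3 powr (3 * j n + N)"
    proof -
      have "X n ^ 3 = 3 powi (j n * 3)" unfolding power_int_mult assms(1) by simp
      also have "\<dots> = 3 powr (3 * j n)" by (simp add: powr_real_of_int'[symmetric] mult.commute)
      finally show ?thesis by (simp add: powr_add powr_realpow)
    qed
    finally have "3 powr c \<le> 3 powr (3 * j n + N)" using assms(3)[of n] by (rule order_trans[rotated])
    then have "real_of_int c \<le> 3 * j n + N" by (subst (asm) powr_le_cancel_iff) auto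
    then show ?thesis by linarith
  qed
  moreover have "3 * j n \<le> c" for n using assms(2)[of n] assms(1)[of n] tcpx_powi by simp
  ultimately have "finite (range X)" using powi_seq_finite[of j c N] assms(1) by presburger
  then obtain \<phi> x where "strict_mono \<phi>" "\<forall>n::nat. X (\<phi> n) = x"
    using finite_range_const_subseq[of X] by blast
  then show ?thesis unfolding settled_def by (intro exI[of _ \<phi>]) auto
qed

text \<open>In \<open>m = a + b\<close> with bounded defect the smaller summand \<open>b\<close> is bounded, so along a subsequence
  it is constant and its contribution to \<open>(a + b) / 3 ^ k\<close> tends to \<open>0\<close>.\<close>

lemma settled_add_const:
  fixes X :: "nat \<Rightarrow> real" and a :: "nat \<Rightarrow> nat" and k :: "nat \<Rightarrow> int" and b N :: nat and c K :: int
  assumes IH: "\<And>c Y. (\<And>n::nat. Y n \<in> tern) \<Longrightarrow> (\<And>n. tcpx (Y n) \<le> c) \<Longrightarrow>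
      (\<And>n. 3 powr c \<le> Y n ^ 3 * (9/8) ^ N) \<Longrightarrow> \<exists>\<phi>::nat \<Rightarrow> nat. strict_mono \<phi> \<and> settled c (Y \<circ> \<phi>)"
    and X: "\<And>n. X n = real (a n + b) / 3 powi k n" and b: "b > 0"
    and cpx: "\<And>n. int (cpx (a n) + cpx b) \<le> c + 3 * k n"
    and lower: "\<And>n. 3 powr c \<le> X n ^ 3 * (9/8) ^ Suc N"
    and k: "\<And>n. int n \<le> k n + K"
  shows "\<exists>\<phi>::nat \<Rightarrow> nat. strict_mono \<phi> \<and> settled c (X \<circ> \<phi>)"
proof -
  \<comment> \<open>A positive lower bound for all terms; the minimum with \<open>1\<close> gives
    \<open>e ^ 3 \<le> e\<close> and saves a cube root.\<close>
  define e where "e = min 1 (3 powr c / (9/8) ^ Suc N :: real)"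
  have e: "e > 0" "e \<le> 1" unfolding e_def by auto
  have Xe: "e \<le> X n" for n
  proof (rule power_le_imp_le_base[of _ 2])
    have "e ^ Suc 2 \<le> e ^ 1" using e by (intro power_decreasing) auto
    also have "\<dots> \<le> 3 powr c / (9/8) ^ Suc N" unfolding e_def by simp
    also have "\<dots> \<le> X n ^ 3" using lower[of n] by (subst pos_divide_le_eq) auto
    finally show "e ^ Suc 2 \<le> X n ^ Suc 2" by (simp add: eval_nat_numeral)
    show "0 \<le> X n" unfolding X by simp
  qed
  have pk: "(3::real) ^ n \<le> 3 powi k n * 3 powi K" for n
  proof -
    have "(3::real) ^ n = 3 powi int n" by simp
    also have "\<dots> \<le> 3 powi (k n + K)" using k[of n] by (intro power_int_increasing) auto
    finally show ?thesis by (simp add: power_int_add)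
  qed
  obtain n0 where n0: "4 * real b * 3 powi K / e < 3 ^ n0" using real_arch_pow[of 3] by auto
  have ab: "3 * b \<le> a n" if "n \<ge> n0" for n
  proof -
    have "4 * real b * 3 powi K / e < 3 ^ n"
      using n0 power_increasing[OF that, of "3::real"] by linarith
    also have "\<dots> \<le> 3 powi k n * 3 powi K" by (rule pk)
    finally have "4 * real b < 3 powi k n * e" using e by (simp add: field_simps)
    also have "\<dots> \<le> 3 powi k n * X n" using Xe by (intro mult_left_mono) auto
    also have "\<dots> = real (a n + b)" unfolding X by simp
    finally show ?thesis by linarith
  qed
  define Y where "Y n = real (a (n + n0)) * 3 powi (- k (n + n0))" for n
  have ap: "a (n + n0) > 0" for n using ab[of "n + n0"] b by auto
  have Yt: "Y n \<in> tern" for n unfolding Y_def using ap by (intro tern_scale(1) tern_of_nat)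
  have Yc: "tcpx (Y n) \<le> c - int (cpx b)" for n
  proof -
    have "tcpx (Y n) = tcpx (real (a (n + n0))) + 3 * (- k (n + n0))"
      unfolding Y_def using ap by (intro tern_scale(2) tern_of_nat)
    then show ?thesis using tcpx_of_nat[OF ap[of n]] stable_cpx_le[OF ap[of n]] cpx[of "n + n0"] by simp
  qed
  have XY: "X (n + n0) = Y n + real b * 3 powi (- k (n + n0))" for n
    unfolding X Y_def by (simp add: power_int_minus field_simps)
  \<comment> \<open>Dropping \<open>b\<close> lowers the complexity bound by at least
    \<open>1\<close>, a factor \<open>1/3\<close>, while \<open>X \<le> 4/3 * Y\<close> costs at
    most \<open>64/27\<close> in the cube. As \<open>9/8 * 64/27 / 3 = 8/9 < 1\<close>, one factor
    \<open>9/8\<close> of the defect is saved.\<close>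
  have Yl: "3 powr real_of_int (c - int (cpx b)) \<le> Y n ^ 3 * (9/8) ^ N" for n
  proof -
    have "3 * (real b * 3 powi (- k (n + n0))) \<le> Y n"
      unfolding Y_def using ab[of "n + n0"] by (simp add: mult.assoc[symmetric] mult_right_mono)
    then have "3 * X (n + n0) \<le> 4 * Y n" unfolding XY by (simp add: algebra_simps)
    then have "(3 * X (n + n0)) ^ 3 \<le> (4 * Y n) ^ 3"
      using Xe[of "n + n0"] e by (intro power_mono) auto
    then have *: "27 * X (n + n0) ^ 3 \<le> 64 * Y n ^ 3" unfolding power_mult_distrib by simp
    have "3 powr real_of_int (c - int (cpx b)) \<le> 3 powr (real_of_int c - 1)"
      using cpx_pos[OF b] by (intro powr_mono) auto
    also have "\<dots> = 3 powr c / 3" by (simp add: powr_diff)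
    also have "\<dots> \<le> X (n + n0) ^ 3 * (9/8) ^ Suc N / 3" using lower by (intro divide_right_mono) auto
    also have "\<dots> = (27 * X (n + n0) ^ 3) * ((9/8) ^ N / 72)" by simp
    also have "\<dots> \<le> (64 * Y n ^ 3) * ((9/8) ^ N / 72)" using * by (intro mult_right_mono) auto
    also have "\<dots> \<le> Y n ^ 3 * (9/8) ^ N" using tern_pos[OF Yt[of n]] by simp
    finally show ?thesis .
  qed
  from IH[of Y, OF Yt Yc Yl] obtain \<phi> where \<phi>: "strict_mono \<phi>" "settled (c - int (cpx b)) (Y \<circ> \<phi>)" by blast
  define \<psi> where "\<psi> n = \<phi> n + n0" for n
  have \<psi>: "strict_mono \<psi>" using \<phi>(1) unfolding \<psi>_def strict_mono_def by auto
  define z where "z n = real b * 3 powi (- k (\<psi> n))" for n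
  have zpos: "z n > 0" for n unfolding z_def using b by simp
  have "z n \<le> real b * 3 powi K * (1/3) ^ n" for n
  proof -
    have "(3::real) ^ n \<le> 3 ^ \<psi> n" using seq_suble[OF \<psi>] by (intro power_increasing) auto
    also have "\<dots> \<le> 3 powi k (\<psi> n) * 3 powi K" by (rule pk)
    finally have "(3::real) powi (- k (\<psi> n)) \<le> 3 powi K * (1/3) ^ n"
      by (simp add: power_int_minus field_simps)
    then show ?thesis unfolding z_def using b by (simp add: mult.assoc)
  qed
  moreover have "(\<lambda>n. real b * 3 powi K * (1/3) ^ n) \<longlonglongrightarrow> real b * 3 powi K * 0"
    by (intro tendsto_intros LIMSEQ_power_zero) auto
  ultimately have z0: "z \<longlonglongrightarrow> 0"
    using zpos by (intro tendsto_sandwich[of "\<lambda>_. 0" z _ "\<lambda>n. real b * 3 powi K * (1/3) ^ n"])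
      (simp_all add: less_imp_le)
  have Xz: "(X \<circ> \<psi>) n = (Y \<circ> \<phi>) n + z n" for n unfolding \<psi>_def z_def o_def XY ..
  have lim: "(X \<circ> \<psi>) \<longlonglongrightarrow> y" if "(Y \<circ> \<phi>) \<longlonglongrightarrow> y" for y
  proof -
    have "(X \<circ> \<psi>) = (\<lambda>n. (Y \<circ> \<phi>) n + z n)" by (rule ext) (rule Xz)
    then show ?thesis using tendsto_add[OF that z0] by simp
  qed
  from \<phi>(2) have "settled c (X \<circ> \<psi>)"
  proof (cases rule: settled_cases)
    case (1 y)
    then have y: "y \<in> tern" "tcpx y \<le> c - int (cpx b)" using Yt[of "\<phi> 0"] Yc[of "\<phi> 0"] by (auto simp: o_def)
    have "(Y \<circ> \<phi>) = (\<lambda>_. y)" by (rule ext) (rule 1[rule_format])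
    then have "(X \<circ> \<psi>) \<longlonglongrightarrow> y" using lim[of y] by (simp only: tendsto_const)
    moreover have "\<forall>n. (X \<circ> \<psi>) n > y"
    proof
      fix n show "y < (X \<circ> \<psi>) n" unfolding Xz 1[rule_format, of n] using zpos[of n] by simp
    qed
    moreover have "tcpx y \<le> c - 2 \<or> tcpx y = c - 1 \<and>
       (\<exists>\<alpha> \<beta>. good_factor y \<alpha> \<beta> \<and> (\<forall>n. \<exists>r::int. (X \<circ> \<psi>) n = \<beta> * (\<alpha> + 3 powi r)))"
    proof (cases "tcpx y \<le> c - 2")
      case False
      \<comment> \<open>A loss of exactly one forces the summand \<open>1\<close>. Here the shape
        \<open>\<beta> * (\<alpha> + 3 powi r)\<close> is born, with
        \<open>\<beta> = 1\<close>.\<close>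
      then have "cpx b = 1" using y(2) cpx_pos[OF b] by linarith
      then have "b = 1" using cpx_eq_1D[OF b] by simp
      have "good_factor y y 1" unfolding good_factor_def using y tern_1 tcpx_1 by simp
      moreover have "tcpx y = c - 1" using False y(2) \<open>cpx b = 1\<close> by linarith
      moreover have "\<forall>n. \<exists>r::int. (X \<circ> \<psi>) n = 1 * (y + 3 powi r)"
      proof
        fix n
        have "(X \<circ> \<psi>) n = 1 * (y + 3 powi (- k (\<psi> n)))"
          unfolding Xz z_def 1[rule_format, of n] \<open>b = 1\<close> by simp
        then show "\<exists>r::int. (X \<circ> \<psi>) n = 1 * (y + 3 powi r)" by (rule exI)
      qed
      ultimately show ?thesis by (intro disjI2 conjI exI[of _ y] exI[of _ 1])
    qed simp
    ultimately show ?thesis by (rule settled_limI[OF y(1)])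
  next
    case (2 y)
    have "(X \<circ> \<psi>) \<longlonglongrightarrow> y" by (rule lim) (rule 2(2))
    moreover have "\<forall>n. (X \<circ> \<psi>) n > y" unfolding Xz
    proof
      fix n show "y < (Y \<circ> \<phi>) n + z n" using 2(3)[rule_format, of n] zpos[of n] by linarith
    qed
    moreover have "tcpx y \<le> c - 2" using 2(4) cpx_pos[OF b] by linarith
    ultimately show ?thesis using settled_limI[OF 2(1)] by blast
  qed
  then show ?thesis using \<psi> by blast
qed

lemma settled_of_subseq:
  fixes X :: "nat \<Rightarrow> real" and \<phi> :: "nat \<Rightarrow> nat"
  assumes "strict_mono \<phi>" "\<exists>\<psi>. strict_mono \<psi> \<and> settled c ((X \<circ> \<phi>) \<circ> \<psi>)"
  shows "\<exists>\<phi>::nat \<Rightarrow> nat. strict_mono \<phi> \<and> settled c (X \<circ> \<phi>)"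
proof -
  obtain \<psi> where \<psi>: "strict_mono \<psi>" "settled c ((X \<circ> \<phi>) \<circ> \<psi>)" using assms(2) by blast
  have "settled c (X \<circ> (\<phi> \<circ> \<psi>))" using \<psi>(2) by (simp only: comp_assoc)
  then show ?thesis using strict_mono_o[OF assms(1) \<psi>(1)] by blast
qed

text \<open>Since \<open>a + b \<le> 2 * a\<close>, comparing \<open>a ^ 3 * b ^ 3\<close> with the
  defect bound cancels \<open>a\<close> and leaves \<open>b ^ 3 \<le> 8 * W\<close>. With
  \<open>b\<close> frozen, either the exponents grow, or they are constant and the upper bound on
  \<open>X\<close> leaves finitely many numerators.\<close>

lemma settled_add:
  fixes X :: "nat \<Rightarrow> real" and a b :: "nat \<Rightarrow> nat" and k :: "nat \<Rightarrow> int" and N :: nat and c :: int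
  assumes IH: "\<And>c Y. (\<And>n::nat. Y n \<in> tern) \<Longrightarrow> (\<And>n. tcpx (Y n) \<le> c) \<Longrightarrow>
      (\<And>n. 3 powr c \<le> Y n ^ 3 * (9/8) ^ N) \<Longrightarrow> \<exists>\<phi>::nat \<Rightarrow> nat. strict_mono \<phi> \<and> settled c (Y \<circ> \<phi>)"
    and X: "\<And>n. X n = real (a n + b n) / 3 powi k n" and ba: "\<And>n. 0 < b n" "\<And>n. b n \<le> a n"
    and cpx: "\<And>n. int (cpx (a n) + cpx (b n)) \<le> c + 3 * k n"
    and upper: "\<And>n. X n ^ 3 \<le> 3 powr c"
    and lower: "\<And>n. 3 powr c \<le> X n ^ 3 * (9/8) ^ Suc N"
  shows "\<exists>\<phi>::nat \<Rightarrow> nat. strict_mono \<phi> \<and> settled c (X \<circ> \<phi>)"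
proof -
  define W where "W = (9/8::real) ^ Suc N"
  have p3: "(3::real) powr (3 * k n) = (3 powi k n) ^ 3" for n
  proof -
    have "(3::real) powr (3 * k n) = 3 powi (k n * 3)" by (simp add: powr_real_of_int'[symmetric] mult.commute)
    then show ?thesis unfolding power_int_mult by simp
  qed
  have "real (b n) \<le> 8 * W" for n
  proof -
    have "real (a n ^ 3 * b n ^ 3) \<le> real (3 ^ cpx (a n) * 3 ^ cpx (b n))"
      using cpx_cube[of "a n"] cpx_cube[of "b n"] ba[of n] by (intro of_nat_mono mult_mono) auto
    also have "\<dots> = 3 powr real_of_int (int (cpx (a n) + cpx (b n)))" by (simp add: powr_add powr_realpow)
    also have "\<dots> \<le> 3 powr real_of_int (c + 3 * k n)" using cpx[of n] by (intro powr_mono) (auto simp del: of_int_add of_nat_add)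
    also have "\<dots> = 3 powr c * (3 powi k n) ^ 3" unfolding p3[symmetric] by (simp add: powr_add)
    also have "\<dots> \<le> (X n ^ 3 * W) * (3 powi k n) ^ 3" using lower[of n] unfolding W_def by (intro mult_right_mono) auto
    also have "\<dots> = real (a n + b n) ^ 3 * W" unfolding X power_divide by simp
    also have "\<dots> \<le> (2 * real (a n)) ^ 3 * W" unfolding W_def using ba(2)[of n] by (intro mult_right_mono power_mono) auto
    also have "\<dots> = real (a n) ^ 3 * (8 * W)" by (simp add: power_mult_distrib)
    finally have "real (b n) ^ 3 \<le> 8 * W" using ba[of n] by simp
    moreover have "real (b n) ^ 1 \<le> real (b n) ^ 3" using ba(1)[of n] by (intro power_increasing) auto
    ultimately show ?thesis unfolding power_one_right by (rule order_trans[rotated])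
  qed
  then have "b n \<le> nat \<lceil>8 * W\<rceil>" for n by (meson of_nat_le_iff order_trans real_nat_ceiling_ge)
  then have "range b \<subseteq> {.. nat \<lceil>8 * W\<rceil>}" by blast
  then have "finite (range b)" using finite_subset by blast
  then obtain \<phi> b0 where \<phi>: "strict_mono \<phi>" "\<forall>n::nat. b (\<phi> n) = b0" using finite_range_const_subseq[of b] by blast
  \<comment> \<open>The shift by \<open>\<bar>c\<bar>\<close> makes the exponents natural numbers:
    complexities are nonnegative, so \<open>c + 3 * k n \<ge> 0\<close>.\<close>
  obtain \<psi> where \<psi>: "strict_mono \<psi>" "(\<exists>l. \<forall>n. nat (k (\<phi> (\<psi> n)) + \<bar>c\<bar>) = l) \<or> (\<forall>n. n \<le> nat (k (\<phi> (\<psi> n)) + \<bar>c\<bar>))"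
    using nat_seq_const_or_strict_mono_subseq[of "\<lambda>n. nat (k (\<phi> n) + \<bar>c\<bar>)"] by blast
  define \<theta> where "\<theta> = \<phi> \<circ> \<psi>"
  have \<theta>: "strict_mono \<theta>" unfolding \<theta>_def using \<phi>(1) \<psi>(1) by (rule strict_mono_o)
  have kn: "k n + \<bar>c\<bar> \<ge> 0" for n using cpx[of n] by linarith
  show ?thesis
  proof (rule settled_of_subseq[OF \<theta>])
    from \<psi>(2) show "\<exists>\<psi>. strict_mono \<psi> \<and> settled c ((X \<circ> \<theta>) \<circ> \<psi>)"
    proof
      assume "\<forall>n. n \<le> nat (k (\<phi> (\<psi> n)) + \<bar>c\<bar>)"
      then have kt: "n \<le> nat (k (\<theta> n) + \<bar>c\<bar>)" for n unfolding \<theta>_def by simp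
      have "int n \<le> k (\<theta> n) + \<bar>c\<bar>" for n using kn[of "\<theta> n"] kt[of n] by (simp add: le_nat_iff)
      moreover have b0: "b (\<theta> n) = b0" for n using \<phi>(2) unfolding \<theta>_def by simp
      moreover have "b0 > 0" using ba(1)[of "\<theta> 0"] b0 by simp
      ultimately show ?thesis
        using X[of "\<theta> _"] cpx[of "\<theta> _"] lower[of "\<theta> _"]
        by (intro settled_add_const[OF IH, where a = "a \<circ> \<theta>" and b = b0 and k = "k \<circ> \<theta>" and K = "\<bar>c\<bar>"])
          (simp_all only: o_apply)
    next
      assume "\<exists>l. \<forall>n. nat (k (\<phi> (\<psi> n)) + \<bar>c\<bar>) = l"
      then obtain l where "\<forall>n. nat (k (\<theta> n) + \<bar>c\<bar>) = l" unfolding \<theta>_def by auto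
      then have k: "k (\<theta> n) = int l - \<bar>c\<bar>" for n using kn[of "\<theta> n"] by (simp add: nat_eq_iff)
      define p where "p = (3::real) powi (int l - \<bar>c\<bar>)"
      have "p > 0" unfolding p_def by simp
      have Xp: "X (\<theta> n) = real (a (\<theta> n) + b (\<theta> n)) / p" for n unfolding p_def X k ..
      have "real (a (\<theta> n) + b (\<theta> n)) \<le> (3 powr c + 1) * p" for n
      proof -
        \<comment> \<open>Bounds \<open>X\<close> through its cube without extracting a
          root.\<close>
        have "X (\<theta> n) \<le> X (\<theta> n) ^ 3 + 1"
        proof (cases "X (\<theta> n) \<le> 1")
          case True
          moreover have "X (\<theta> n) ^ 3 \<ge> 0" unfolding X by simp
          ultimately show ?thesis by linarith
        next
          case False
          then have "X (\<theta> n) ^ 1 \<le> X (\<theta> n) ^ 3" by (intro power_increasing) auto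
          then show ?thesis by simp
        qed
        then have "X (\<theta> n) \<le> 3 powr c + 1" using upper[of "\<theta> n"] by linarith
        then show ?thesis unfolding Xp using \<open>p > 0\<close> by (simp add: pos_divide_le_eq)
      qed
      then have "a (\<theta> n) + b (\<theta> n) \<le> nat \<lceil>(3 powr c + 1) * p\<rceil>" for n
        by (meson of_nat_le_iff order_trans real_nat_ceiling_ge)
      then have "range (X \<circ> \<theta>) \<subseteq> (\<lambda>m. real m / p) ` {.. nat \<lceil>(3 powr c + 1) * p\<rceil>}"
        unfolding o_def Xp by blast
      then have "finite (range (X \<circ> \<theta>))" using finite_subset by blast
      then obtain \<omega> x where "strict_mono \<omega>" "\<forall>n::nat. (X \<circ> \<theta>) (\<omega> n) = x"
        using finite_range_const_subseq[of "X \<circ> \<theta>"] by blast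
      then show ?thesis unfolding settled_def by (intro exI[of _ \<omega>]) auto
    qed
  qed
qed

text \<open>The factors may drift apart by powers of \<open>3\<close>, one tending to
  \<open>0\<close> and the other to infinity. Moving \<open>3 powi q n\<close> between them confines
  the complexity of the first to \<open>{0..2}\<close>; along a subsequence it is a constant
  \<open>d\<close>, and both factors obey fixed bounds \<open>d\<close> and
  \<open>c - d\<close>.\<close>

lemma settled_factor:
  fixes X :: "nat \<Rightarrow> real" and y z :: "nat \<Rightarrow> real" and N :: nat and c :: int
  assumes IH: "\<And>c Y. (\<And>n::nat. Y n \<in> tern) \<Longrightarrow> (\<And>n. tcpx (Y n) \<le> c) \<Longrightarrow>
      (\<And>n. 3 powr c \<le> Y n ^ 3 * (9/8) ^ N) \<Longrightarrow> \<exists>\<phi>::nat \<Rightarrow> nat. strict_mono \<phi> \<and> settled c (Y \<circ> \<phi>)"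
    and X: "\<And>n. good_factor (X n) (y n) (z n)"
    and np: "\<And>n j. y n \<noteq> 3 powi j" "\<And>n j. z n \<noteq> 3 powi j"
    and upper: "\<And>n. tcpx (X n) \<le> c"
    and lower: "\<And>n. 3 powr c \<le> X n ^ 3 * (9/8) ^ Suc N"
  shows "\<exists>\<phi>::nat \<Rightarrow> nat. strict_mono \<phi> \<and> settled c (X \<circ> \<phi>)"
proof -
  have f: "y n \<in> tern" "z n \<in> tern" "X n = y n * z n" "tcpx (X n) = tcpx (y n) + tcpx (z n)" for n
    using X[of n] unfolding good_factor_def by auto
  define q where "q n = tcpx (y n) div 3" for n
  define s where "s n = y n * 3 powi (- q n)" for n
  define t where "t n = z n * 3 powi q n" for n
  have ts: "tcpx (s n) = tcpx (y n) - 3 * q n" and tt: "tcpx (t n) = tcpx (z n) + 3 * q n"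
    and st: "s n \<in> tern" "t n \<in> tern" for n
    using tern_scale[OF f(1)[of n], of "- q n"] tern_scale[OF f(2)[of n], of "q n"]
    unfolding s_def t_def by simp_all
  have Xst: "X n = s n * t n" for n
    unfolding f(3)[of n] s_def t_def by (simp add: power_int_minus)
  have ts_mod: "tcpx (s n) = tcpx (y n) mod 3" for n
    unfolding ts q_def by (rule minus_mult_div_eq_mod)
  have snp: "\<forall>j. s n \<noteq> 3 powi j" for n
  proof (intro allI notI)
    fix j assume "s n = 3 powi j"
    then have "y n = 3 powi (j + q n)" unfolding s_def by (simp add: power_int_add power_int_minus field_simps)
    then show False using np by blast
  qed
  have tnp: "\<forall>j. t n \<noteq> 3 powi j" for n
  proof (intro allI notI)
    fix j assume "t n = 3 powi j"
    then have "z n = 3 powi (j - q n)" unfolding t_def by (simp add: power_int_diff field_simps)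
    then show False using np by blast
  qed
  have "range (\<lambda>n. tcpx (s n)) \<subseteq> {0..2}" unfolding ts_mod by auto
  then have "finite (range (\<lambda>n. tcpx (s n)))" using finite_subset by blast
  then obtain \<phi> d where \<phi>: "strict_mono \<phi>" "\<forall>n::nat. tcpx (s (\<phi> n)) = d"
    using finite_range_const_subseq[of "\<lambda>n. tcpx (s n)"] by blast
  have tc: "tcpx (t (\<phi> n)) \<le> c - d" for n 
    using ts[of "\<phi> n"] tt[of "\<phi> n"] f(4)[of "\<phi> n"] \<phi>(2)[rule_format, of n] upper[of "\<phi> n"] by linarith
  \<comment> \<open>The partner \<open>v\<close> is no power of \<open>3\<close>, so the gap uses up
    one factor \<open>9/8\<close> of the defect and leaves \<open>u\<close> with
    \<open>N\<close>.\<close>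
  have split: "3 powr e \<le> u ^ 3 * (9/8) ^ N"
    if "u > 0" "v \<in> tern" "\<forall>j. v \<noteq> 3 powi j" "tcpx v \<le> c - e" "3 powr c \<le> (u * v) ^ 3 * (9/8) ^ Suc N"
    for u v and e :: int
  proof -
    have "9 * v ^ 3 \<le> 8 * 3 powr tcpx v" using that by (intro tcpx_gap) auto
    also have "\<dots> \<le> 8 * 3 powr real_of_int (c - e)" using that(4) by (intro mult_left_mono powr_mono) auto
    finally have v: "v ^ 3 * (9/8) \<le> 3 powr real_of_int (c - e)" by simp
    have "3 powr e * 3 powr real_of_int (c - e) = 3 powr c" by (simp add: powr_add[symmetric])
    also have "\<dots> \<le> (u ^ 3 * (9/8) ^ N) * (v ^ 3 * (9/8))" using that(5) by (simp add: power_mult_distrib mult_ac)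
    also have "\<dots> \<le> (u ^ 3 * (9/8) ^ N) * 3 powr real_of_int (c - e)" using v that(1) by (intro mult_left_mono) auto
    finally show ?thesis by simp
  qed
  have s1: "(s \<circ> \<phi>) n \<in> tern" and s2: "tcpx ((s \<circ> \<phi>) n) \<le> d" for n
    using st(1) \<phi>(2) by simp_all
  have s3: "3 powr d \<le> (s \<circ> \<phi>) n ^ 3 * (9/8) ^ N" for n
    unfolding o_apply
    by (rule split[OF tern_pos[OF st(1)] st(2) tnp tc lower[of "\<phi> n", unfolded Xst]])
  obtain \<psi> where \<psi>: "strict_mono \<psi>" "settled d ((s \<circ> \<phi>) \<circ> \<psi>)"
    using IH[of "s \<circ> \<phi>" d, OF s1 s2 s3] by blast
  have t1: "(t \<circ> \<phi> \<circ> \<psi>) n \<in> tern" and t2: "tcpx ((t \<circ> \<phi> \<circ> \<psi>) n) \<le> c - d" for n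
    using st(2) tc by simp_all
  have t3: "3 powr real_of_int (c - d) \<le> (t \<circ> \<phi> \<circ> \<psi>) n ^ 3 * (9/8) ^ N" for n
    unfolding o_apply
  proof (rule split[OF tern_pos[OF st(2)] st(1) snp])
    show "tcpx (s (\<phi> (\<psi> n))) \<le> c - (c - d)" using \<phi>(2) by simp
    show "3 powr c \<le> (t (\<phi> (\<psi> n)) * s (\<phi> (\<psi> n))) ^ 3 * (9/8) ^ Suc N"
      using lower[of "\<phi> (\<psi> n)"] unfolding Xst by (simp only: mult.commute)
  qed
  obtain \<theta> where \<theta>: "strict_mono \<theta>" "settled (c - d) ((t \<circ> \<phi> \<circ> \<psi>) \<circ> \<theta>)"
    using IH[of "t \<circ> \<phi> \<circ> \<psi>" "c - d", OF t1 t2 t3] by blast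
  have settled_st: "settled (d + (c - d)) (\<lambda>n. ((s \<circ> \<phi> \<circ> \<psi>) \<circ> \<theta>) n * ((t \<circ> \<phi> \<circ> \<psi>) \<circ> \<theta>) n)"
    using s1[of "\<psi> (\<theta> _)"] s2[of "\<psi> (\<theta> _)"] t1[of "\<theta> _"] t2[of "\<theta> _"]
    by (intro settled_mult[OF settled_subseq[OF \<psi>(2) \<theta>(1)] \<theta>(2)]) (simp_all only: o_apply)
  have eq: "(\<lambda>n. ((s \<circ> \<phi> \<circ> \<psi>) \<circ> \<theta>) n * ((t \<circ> \<phi> \<circ> \<psi>) \<circ> \<theta>) n) = X \<circ> (\<phi> \<circ> \<psi> \<circ> \<theta>)"
    by (rule ext) (simp only: o_apply Xst)
  have "d + (c - d) = c" by simp
  then have "settled c (X \<circ> (\<phi> \<circ> \<psi> \<circ> \<theta>))" using settled_st unfolding eq by (simp only:)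
  moreover have "strict_mono (\<phi> \<circ> \<psi> \<circ> \<theta>)"
    by (rule strict_mono_o[OF strict_mono_o[OF \<phi>(1) \<psi>(1)] \<theta>(1)])
  ultimately show ?thesis by blast
qed

section \<open>Induction on the defect\<close>

lemma infinitely_often_subseq:
  assumes "infinite {n. P n}" shows "\<exists>\<phi>. strict_mono (\<phi> :: nat \<Rightarrow> nat) \<and> (\<forall>n. P (\<phi> n))"
  using infinite_enumerate[OF assms] by auto

text \<open>The bound \<open>c\<close> varies in the induction, since factors and summands come with
  bounds of their own. For \<open>N = 0\<close> the gap leaves only powers of \<open>3\<close>;
  otherwise one of the three shapes (power, product, sum) occurs infinitely often.\<close>

lemma settled_subseq_exists_of_defect:
  fixes X :: "nat \<Rightarrow> real"
  assumes "\<And>n. X n \<in> tern" "\<And>n. tcpx (X n) \<le> c" "\<And>n. 3 powr c \<le> X n ^ 3 * (9/8) ^ N"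
  shows "\<exists>\<phi>::nat \<Rightarrow> nat. strict_mono \<phi> \<and> settled c (X \<circ> \<phi>)"
  using assms
proof (induction N arbitrary: X c)
  case (0 X c)
  have "\<exists>j. X n = 3 powi j" for n
  proof (rule ccontr)
    assume "\<not> ?thesis"
    then have "9 * X n ^ 3 \<le> 8 * 3 powr tcpx (X n)" using 0 by (intro tcpx_gap) auto
    also have "\<dots> \<le> 8 * 3 powr c" using 0(2)[of n] by (intro mult_left_mono powr_mono) auto
    also have "\<dots> \<le> 8 * X n ^ 3" using 0(3)[of n] by simp
    finally show False using tern_pos[OF 0(1)[of n]] by simp
  qed
  then obtain j where "\<And>n. X n = 3 powi j n" by metis
  then show ?case using 0(2,3) by (rule settled_powi)
next
  case (Suc N X c)
  define P where "P n \<longleftrightarrow> (\<exists>j. X n = 3 powi j)" for n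
  define Q where "Q n \<longleftrightarrow> (\<exists>y z. (\<forall>j. y \<noteq> 3 powi j) \<and> (\<forall>j. z \<noteq> 3 powi j) \<and> good_factor (X n) y z)" for n
  define R where "R n \<longleftrightarrow> (\<exists>a b k. 0 < b \<and> b \<le> a \<and> X n = real (a + b) / 3 powi k \<and>
      int (cpx a + cpx b) = tcpx (X n) + 3 * k)" for n
  have "P n \<or> Q n \<or> R n" for n
    using tern_decompose[OF Suc.prems(1)[of n]] unfolding P_def Q_def R_def by blast
  then have "UNIV = {n. P n} \<union> {n. Q n} \<union> {n. R n}" by blast
  then have "infinite {n. P n} \<or> infinite {n. Q n} \<or> infinite {n. R n}"
    by (metis finite_Un infinite_UNIV_nat)
  note up = Suc.prems(2) and lo = Suc.prems(3)
  from \<open>infinite {n. P n} \<or> infinite {n. Q n} \<or> infinite {n. R n}\<close> show ?case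
  proof (elim disjE)
    assume "infinite {n. P n}"
    then obtain \<phi> :: "nat \<Rightarrow> nat" where \<phi>: "strict_mono \<phi>" "\<forall>n. P (\<phi> n)"
      using infinitely_often_subseq[of P] by blast
    from choice[OF \<phi>(2)[unfolded P_def]] obtain j where j: "\<forall>n. X (\<phi> n) = 3 powi j n" ..
    show ?thesis
    proof (rule settled_of_subseq[OF \<phi>(1)], rule settled_powi)
      show "(X \<circ> \<phi>) n = 3 powi j n" for n unfolding o_apply by (rule j[rule_format])
      show "tcpx ((X \<circ> \<phi>) n) \<le> c" for n unfolding o_apply by (rule up)
      show "3 powr c \<le> (X \<circ> \<phi>) n ^ 3 * (9/8) ^ Suc N" for n unfolding o_apply by (rule lo)
    qed
  next
    assume "infinite {n. Q n}"
    then obtain \<phi> :: "nat \<Rightarrow> nat" where \<phi>: "strict_mono \<phi>" "\<forall>n. Q (\<phi> n)"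
      using infinitely_often_subseq[of Q] by blast
    then obtain y z where "\<forall>n. (\<forall>j. y n \<noteq> 3 powi j) \<and> (\<forall>j. z n \<noteq> 3 powi j) \<and>
        good_factor ((X \<circ> \<phi>) n) (y n) (z n)" 
      using \<phi>(2)[unfolded Q_def] unfolding o_apply choice_iff by (elim exE)
    then have yz: "good_factor ((X \<circ> \<phi>) n) (y n) (z n)" "y n \<noteq> 3 powi j" "z n \<noteq> 3 powi j" for n j
      by blast+
    show ?thesis
    proof (rule settled_of_subseq[OF \<phi>(1)], rule settled_factor[OF Suc.IH _ yz(2,3)])
      show "good_factor ((X \<circ> \<phi>) n) (y n) (z n)" for n by (rule yz(1))
      show "tcpx ((X \<circ> \<phi>) n) \<le> c" for n unfolding o_apply by (rule up)
      show "3 powr c \<le> (X \<circ> \<phi>) n ^ 3 * (9/8) ^ Suc N" for n unfolding o_apply by (rule lo)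
    qed
  next
    assume "infinite {n. R n}"
    then obtain \<phi> :: "nat \<Rightarrow> nat" where \<phi>: "strict_mono \<phi>" "\<forall>n. R (\<phi> n)"
      using infinitely_often_subseq[of R] by blast
    then obtain a b k where ab: "\<forall>n. 0 < b n \<and> b n \<le> a n \<and> (X \<circ> \<phi>) n = real (a n + b n) / 3 powi k n \<and>
      int (cpx (a n) + cpx (b n)) = tcpx ((X \<circ> \<phi>) n) + 3 * k n" 
      using \<phi>(2)[unfolded R_def] unfolding o_apply choice_iff by (elim exE)
    then have *: "0 < b n" "b n \<le> a n" "(X \<circ> \<phi>) n = real (a n + b n) / 3 powi k n"
      "int (cpx (a n) + cpx (b n)) = tcpx ((X \<circ> \<phi>) n) + 3 * k n" for n by blast+
    have upc: "(X \<circ> \<phi>) n ^ 3 \<le> 3 powr c" for n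
    proof -
      have "3 powr tcpx (X (\<phi> n)) \<le> 3 powr c" using Suc.prems(2)[of "\<phi> n"] by (intro powr_mono) auto
      then show ?thesis using tcpx_cube[OF Suc.prems(1)[of "\<phi> n"]] unfolding o_apply by linarith
    qed
    have cp: "int (cpx (a n) + cpx (b n)) \<le> c + 3 * k n" for n
      using *(4)[of n] Suc.prems(2)[of "\<phi> n"] unfolding o_apply by linarith
    show ?thesis
    proof (rule settled_of_subseq[OF \<phi>(1)], rule settled_add[OF Suc.IH *(3) *(1) *(2) cp upc])
      show "3 powr c \<le> (X \<circ> \<phi>) n ^ 3 * (9/8) ^ Suc N" for n unfolding o_apply by (rule lo)
    qed
  qed
qed

theorem settled_subseq_exists:
  fixes X :: "nat \<Rightarrow> real"
  assumes "\<And>n. X n \<in> tern" "\<And>n. tcpx (X n) \<le> c" "\<And>n. e \<le> X n" "e > 0"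
  shows "\<exists>\<phi>::nat \<Rightarrow> nat. strict_mono \<phi> \<and> settled c (X \<circ> \<phi>)"
proof -
  obtain N where N: "3 powr c / e ^ 3 < (9/8::real) ^ N" using real_arch_pow[of "9/8"] by auto
  have "3 powr c \<le> X n ^ 3 * (9/8) ^ N" for n
  proof -
    have "3 powr c \<le> e ^ 3 * (9/8) ^ N" using N assms(4) by (simp add: field_simps)
    also have "\<dots> \<le> X n ^ 3 * (9/8) ^ N" using assms(3)[of n] assms(4) by (intro mult_right_mono power_mono) auto
    finally show ?thesis .
  qed
  from settled_subseq_exists_of_defect[OF assms(1,2) this] show ?thesis .
qed

section \<open>Limit points\<close>

definition low :: "int \<Rightarrow> real set" where "low c = {x \<in> tern. tcpx x \<le> c}"

definition level :: "int \<Rightarrow> real set" where "level c = {x \<in> tern. tcpx x = c}"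

lemma low_mono: "c \<le> d \<Longrightarrow> low c \<subseteq> low d"
  unfolding low_def by auto

lemma level_eq: "level c = low c - low (c - 1)"
  unfolding low_def level_def by auto

lemma low_pos: "x \<in> low c \<Longrightarrow> x > 0"
  unfolding low_def using tern_pos by auto

lemma low_upper: "x \<in> low c \<Longrightarrow> x ^ 3 \<le> 3 powr c"
proof -
  assume x: "x \<in> low c"
  then have "x ^ 3 \<le> 3 powr tcpx x" unfolding low_def by (intro tcpx_cube) auto
  also have "\<dots> \<le> 3 powr c" using x unfolding low_def by (intro powr_mono) auto
  finally show ?thesis .
qed

lemma low_settled:
  fixes X :: "nat \<Rightarrow> real"
  assumes "\<And>n. X n \<in> low c" "\<And>n. e \<le> X n" "e > 0"
  obtains \<phi> :: "nat \<Rightarrow> nat" where "strict_mono \<phi>" "settled c (X \<circ> \<phi>)"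
  using settled_subseq_exists[of X c e] assms unfolding low_def by blast

text \<open>A positive limit keeps a tail of the sequence away from \<open>0\<close>, and terms
  different from \<open>x\<close> exclude the constant alternative. The first conclusion yields the
  derived set, the second the well order.\<close>

lemma low_seq_limit:
  fixes X :: "nat \<Rightarrow> real"
  assumes "\<And>n. X n \<in> low c" "X \<longlonglongrightarrow> x" "x > 0" "\<And>n. X n \<noteq> x"
  shows "x \<in> low (c - 1)" "\<exists>n. X n > x"
proof -
  have "eventually (\<lambda>n. X n > x / 2) sequentially" using assms(2,3) by (intro order_tendstoD) auto
  then obtain N where N: "\<And>n. n \<ge> N \<Longrightarrow> X n > x / 2" unfolding eventually_sequentially by blast
  have "x / 2 \<le> X (n + N)" for n using N[of "n + N"] by simp
  then obtain \<phi> :: "nat \<Rightarrow> nat" where \<phi>: "strict_mono \<phi>" "settled c ((\<lambda>n. X (n + N)) \<circ> \<phi>)"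
    using low_settled[of "\<lambda>n. X (n + N)" c "x / 2"] assms(1,3) by auto
  have lim: "((\<lambda>n. X (n + N)) \<circ> \<phi>) \<longlonglongrightarrow> x"
    using LIMSEQ_subseq_LIMSEQ[OF LIMSEQ_ignore_initial_segment[OF assms(2)] \<phi>(1)] .
  have "x \<in> low (c - 1) \<and> (\<exists>n. X n > x)"
    using \<phi>(2)
  proof (cases rule: settled_cases)
    case (1 y)
    then have "((\<lambda>n. X (n + N)) \<circ> \<phi>) = (\<lambda>_. y)" by auto
    then have "x = y" using lim by (simp add: LIMSEQ_const_iff)
    then show ?thesis using 1 assms(4)[of "\<phi> 0 + N"] by auto
  next
    case (2 y)
    then have "x = y" using lim LIMSEQ_unique by blast
    then show ?thesis using 2 unfolding low_def by auto
  qed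
  then show "x \<in> low (c - 1)" "\<exists>n. X n > x" by auto
qed

lemma add_small_tendsto:
  fixes \<phi> :: "nat \<Rightarrow> nat"
  assumes "strict_mono \<phi>" shows "(\<lambda>n. x + 1 / 3 ^ \<phi> n) \<longlonglongrightarrow> (x::real)"
proof -
  have "(\<lambda>n. x + (1/3) ^ n) \<longlonglongrightarrow> x + (0::real)"
    by (intro tendsto_intros LIMSEQ_power_zero) auto
  from LIMSEQ_subseq_LIMSEQ[OF this assms] show ?thesis by (simp add: o_def power_one_over)
qed

section \<open>Derived sets and layers\<close>

lemma small_powers_in_low:
  "\<exists>N. \<forall>n\<ge>N. (1/3::real) ^ n \<in> low c"
proof (intro exI allI impI)
  fix n assume n: "nat \<bar>c\<bar> \<le> n"
  have "(1/3::real) ^ n = 3 powi (- int n)" by (simp add: power_int_minus power_one_over field_simps)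
  then show "(1/3::real) ^ n \<in> low c" unfolding low_def using tern_powi[of "- int n"] tcpx_powi[of "- int n"] n by simp
qed

lemma low_unbounded_below: "e > 0 \<Longrightarrow> \<exists>x\<in>low c. x < e"
proof -
  assume "e > 0"
  obtain N where N: "\<forall>n\<ge>N. (1/3::real) ^ n \<in> low c" using small_powers_in_low by blast
  obtain m where m: "(1/3::real) ^ m < e" using real_arch_pow_inv[OF \<open>e > 0\<close>, of "1/3"] by auto
  have "(1/3::real) ^ (max m N) \<le> (1/3) ^ m" by (intro power_decreasing) auto
  also note m
  finally show ?thesis using N by (intro bexI[of _ "(1/3::real) ^ max m N"]) auto
qed

text \<open>One inclusion is compactness, the other the sequence \<open>x + 1 / 3 ^ r\<close>. The
  point \<open>0\<close> survives every derivation because \<open>low c\<close> contains all small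
  powers of \<open>1/3\<close>, for each \<open>c\<close>.\<close>

lemma derived_low: "derived (insert 0 (low c)) = insert 0 (low (c - 1))"
proof (intro equalityI subsetI)
  fix x assume "x \<in> derived (insert 0 (low c))"
  then have lp: "x islimpt low c" unfolding derived_def by (simp add: islimpt_insert)
  then obtain X where X: "\<And>n. X n \<in> low c - {x}" "X \<longlonglongrightarrow> x" unfolding islimpt_sequential by blast
  have "x \<ge> 0"
    by (rule LIMSEQ_le_const[OF X(2)]) (use X(1) low_pos less_imp_le in blast)
  then show "x \<in> insert 0 (low (c - 1))"
    using low_seq_limit(1)[of X c x] X by (cases "x = 0") auto
next
  fix x assume "x \<in> insert 0 (low (c - 1))"
  then have "x islimpt low c"
  proof
    assume x: "x = 0"
    have "\<exists>y\<in>low c. y \<noteq> x \<and> dist y x < e" if e: "e > 0" for e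
    proof -
      obtain y where "y \<in> low c" "y < e" using low_unbounded_below[OF e, of c] by blast
      then show ?thesis using low_pos[of y c] x by (intro bexI[of _ y]) (auto simp: dist_real_def)
    qed
    then show ?thesis unfolding islimpt_approachable by blast
  next
    assume x: "x \<in> low (c - 1)"
    then have "eventually (\<lambda>r. x + 1 / 3 ^ r \<in> tern \<and> tcpx (x + 1 / 3 ^ r) \<le> tcpx x + 1) sequentially"
      unfolding low_def by (intro tern_add_small) auto
    then obtain N where N: "\<And>r. r \<ge> N \<Longrightarrow> x + 1 / 3 ^ r \<in> low c"
      using x unfolding eventually_sequentially low_def by fastforce
    have "strict_mono (\<lambda>n. n + N)" by (simp add: strict_mono_def)
    from add_small_tendsto[OF this] have "(\<lambda>n. x + 1 / 3 ^ (n + N)) \<longlonglongrightarrow> x" .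
    moreover have "x + 1 / 3 ^ (n + N) \<in> low c - {x}" for n using N[of "n + N"] by simp
    ultimately show ?thesis
      unfolding islimpt_sequential by (intro exI[of _ "\<lambda>n. x + 1 / 3 ^ (n + N)"]) simp
  qed
  then show "x \<in> derived (insert 0 (low c))" unfolding derived_def by (simp add: islimpt_insert)
qed

lemma iter_derived_low: "iter_derived u (insert 0 (low c)) = insert 0 (low (c - int u))"
proof (induction u)
  case (Suc u)
  have "iter_derived (Suc u) (insert 0 (low c)) = derived (iter_derived u (insert 0 (low c)))"
    unfolding iter_derived_def by simp
  then show ?case using Suc derived_low[of "c - int u"] by (simp add: algebra_simps)
qed (simp add: iter_derived_def)

lemma Tlayer_low: "Tlayer u (insert 0 (low c)) = level (c - int u)"
  using low_pos[of 0] unfolding Tlayer_def iter_derived_low level_eq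
  by (auto simp: algebra_simps)

section \<open>Compactness and the reverse well order\<close>

lemma low_le: "x \<in> low c \<Longrightarrow> x \<le> 3 powr (c / 3)"
proof (rule power_le_imp_le_base[of _ 2])
  assume x: "x \<in> low c"
  have "((3::real) powr (c / 3)) ^ 3 = 3 powr (c / 3 + c / 3 + c / 3)"
    by (simp only: power3_eq_cube powr_add)
  then have "((3::real) powr (c / 3)) ^ 3 = 3 powr c" by simp
  then show "x ^ Suc 2 \<le> (3 powr (c / 3)) ^ Suc 2" using low_upper[OF x] by (simp only: Suc_numeral semiring_norm)
qed simp

lemma compact_low: "compact (insert 0 (low c))"
proof -
  have "closed (insert 0 (low c))"
    unfolding closed_limpt using derived_low[of c] low_mono[of "c - 1" c] unfolding derived_def by auto
  moreover have "insert 0 (low c) \<subseteq> {0..3 powr (c / 3)}"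
    using low_le[of _ c] less_imp_le[OF low_pos[of _ c]] by auto
  ultimately show ?thesis using compact_eq_bounded_closed bounded_subset bounded_closed_interval by metis
qed

text \<open>A supremum that is not attained would be a limit from below, but some term of any
  sequence converging to it properly lies above it.\<close>

lemma low_has_max:
  assumes "A \<subseteq> low c" "A \<noteq> {}"
  shows "\<exists>m\<in>A. \<forall>y\<in>A. y \<le> m"
proof (rule ccontr)
  assume no: "\<not> ?thesis"
  have bdd: "bdd_above A" using assms(1) low_le by (intro bdd_aboveI[of _ "3 powr (c / 3)"]) auto
  have le: "y \<le> Sup A" if "y \<in> A" for y using that bdd by (rule cSup_upper)
  have nA: "Sup A \<notin> A" using no le by blast
  have "Sup A \<in> closure A" using assms(2) bdd by (rule closure_contains_Sup)
  then obtain X where X: "\<And>n. X n \<in> A" "X \<longlonglongrightarrow> Sup A" unfolding closure_sequential by blast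
  have "Sup A > 0" using le[OF X(1)[of 0]] low_pos[of "X 0" c] X(1)[of 0] assms(1) by force
  moreover have "X n \<in> low c" "X n \<noteq> Sup A" for n using X(1)[of n] assms(1) nA by auto
  ultimately obtain n where "X n > Sup A" using low_seq_limit(2)[OF _ X(2)] by blast
  then show False using le[OF X(1)[of n]] by simp
qed

lemma rev_well_ordered_low: "rev_well_ordered (insert 0 (low c))"
  unfolding rev_well_ordered_def
proof (intro allI impI, elim conjE)
  fix A assume A: "A \<subseteq> insert 0 (low c)" "A \<noteq> {}"
  show "\<exists>m\<in>A. \<forall>y\<in>A. y \<le> m"
  proof (cases "A \<inter> low c = {}")
    case True then have "A = {0}" using A by blast
    then show ?thesis by simp
  next
    case False
    then obtain m where "m \<in> A \<inter> low c" "\<forall>y\<in>A \<inter> low c. y \<le> m" using low_has_max[of "A \<inter> low c" c] by blast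
    then show ?thesis using A low_pos[of m c] by (intro bexI[of _ m]) force+
  qed
qed

text \<open>The compactness statement for infinite sets: an injective sequence cannot have a
  constant subsequence. The shape of the terms is passed on for the arithmetic condition.\<close>

lemma low_accumulates:
  assumes "infinite S" "S \<subseteq> low c" "\<forall>s\<in>S. e \<le> s" "e > 0"
  obtains X :: "nat \<Rightarrow> real" and x where "\<And>n. X n \<in> S" "x \<in> low (c - 1)" "X \<longlonglongrightarrow> x" "\<And>n. X n > x" "e \<le> x"
    "tcpx x = c - 1 \<Longrightarrow> \<exists>\<alpha> \<beta>. good_factor x \<alpha> \<beta> \<and> (\<forall>n. \<exists>r::int. X n = \<beta> * (\<alpha> + 3 powi r))"
proof -
  obtain f :: "nat \<Rightarrow> real" where f: "inj f" "range f \<subseteq> S" using infinite_countable_subset[OF assms(1)] by blast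
  have fS: "f n \<in> S" for n using f by blast
  obtain \<phi> :: "nat \<Rightarrow> nat" where \<phi>: "strict_mono \<phi>" "settled c (f \<circ> \<phi>)"
  proof (rule low_settled[of f c e])
    show "f n \<in> low c" "e \<le> f n" for n using fS[of n] assms(2,3) by auto
  qed (use assms(4) in auto)
  have "f (\<phi> 0) \<noteq> f (\<phi> 1)" using f(1) strict_monoD[OF \<phi>(1), of 0 1] by (auto dest: injD)
  then have nc: "\<not> (\<exists>x. \<forall>n. (f \<circ> \<phi>) n = x)" by (metis comp_apply)
  obtain x where x: "x \<in> tern" "(f \<circ> \<phi>) \<longlonglongrightarrow> x" "\<forall>n. (f \<circ> \<phi>) n > x" "tcpx x \<le> c - 2 \<or>
         tcpx x = c - 1 \<and> (\<exists>\<alpha> \<beta>. good_factor x \<alpha> \<beta> \<and> (\<forall>n. \<exists>r::int. (f \<circ> \<phi>) n = \<beta> * (\<alpha> + 3 powi r)))"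
    using \<phi>(2) nc unfolding settled_def[of c] by blast
  show thesis
  proof (rule that[of "f \<circ> \<phi>" x])
    show "(f \<circ> \<phi>) n \<in> S" for n using fS by simp
    show "x \<in> low (c - 1)" using x(1,4) unfolding low_def by auto
    show "e \<le> x" by (rule LIMSEQ_le_const[OF x(2)]) (use fS assms(3) in auto)
    show "(f \<circ> \<phi>) \<longlonglongrightarrow> x" by (rule x(2))
    show "x < (f \<circ> \<phi>) n" for n using x(3) by blast
    show "\<exists>\<alpha> \<beta>. good_factor x \<alpha> \<beta> \<and> (\<forall>n. \<exists>r::int. (f \<circ> \<phi>) n = \<beta> * (\<alpha> + 3 powi r))" if t: "tcpx x = c - 1"
    proof -
      have "\<not> tcpx x \<le> c - 2" using t by simp
      with x(4) show ?thesis by (elim disjE conjE) (rule notE)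
    qed
  qed
qed

text \<open>The upper bound is \<open>tern_add_small\<close>. If the complexity stayed at most
  \<open>c - 1\<close> infinitely often, the limit \<open>x\<close> would lose one more and lie in
  \<open>low (c - 2)\<close>.\<close>

lemma level_add_small:
  assumes "x \<in> level (c - 1)"
  shows "eventually (\<lambda>r. x + 1 / 3 ^ r \<in> level c) sequentially"
proof -
  have x: "x \<in> tern" "tcpx x = c - 1" using assms unfolding level_def by auto
  have "finite {r. x + 1 / 3 ^ r \<in> low (c - 1)}"
  proof (rule ccontr)
    assume "infinite {r. x + 1 / 3 ^ r \<in> low (c - 1)}"
    from infinite_enumerate[OF this] obtain \<phi> :: "nat \<Rightarrow> nat"
      where \<phi>: "strict_mono \<phi>" "\<And>n. x + 1 / 3 ^ \<phi> n \<in> low (c - 1)" by auto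
    have "x \<in> low (c - 1 - 1)"
      using low_seq_limit(1)[OF \<phi>(2) add_small_tendsto[OF \<phi>(1)] tern_pos[OF x(1)]] by simp
    then show False using x unfolding low_def by simp
  qed
  then have "eventually (\<lambda>r. x + 1 / 3 ^ r \<notin> low (c - 1)) sequentially"
    using eventually_cofinite[of "\<lambda>r. x + 1 / 3 ^ r \<notin> low (c - 1)"] by (simp add: cofinite_eq_sequentially)
  then show ?thesis using tern_add_small[OF x(1)]
    by eventually_elim (use x in \<open>auto simp: low_def level_def\<close>)
qed

text \<open>Climbs from the level of \<open>x\<close> to level \<open>c\<close> one step at a time,
  each step moving right within the remaining room.\<close>

lemma level_near_infinite:
  assumes "x \<in> low (c - 1)" "e > 0"
  shows "infinite {y \<in> level c. x < y \<and> y < x + e}"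
proof -
  have base: "infinite {y \<in> level d. x < y \<and> y < x + e}" if x: "x \<in> level (d - 1)" and e: "e > 0" for x d e
  proof -
    obtain R where R: "\<And>r. r \<ge> R \<Longrightarrow> x + 1 / 3 ^ r \<in> level d"
      using level_add_small[OF x] unfolding eventually_sequentially by blast
    obtain m where m: "(1/3::real) ^ m < e" using real_arch_pow_inv[OF \<open>e > 0\<close>, of "1/3"] by auto
    have "(\<lambda>r. x + (1/3) ^ r) ` {max R m..} \<subseteq> {y \<in> level d. x < y \<and> y < x + e}"
    proof
      fix y assume "y \<in> (\<lambda>r. x + (1/3) ^ r) ` {max R m..}"
      then obtain r where r: "y = x + (1/3) ^ r" "r \<ge> R" "r \<ge> m" by auto
      have "(1/3::real) ^ r \<le> (1/3) ^ m" using r(3) by (intro power_decreasing) auto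
      then show "y \<in> {y \<in> level d. x < y \<and> y < x + e}" using R[OF r(2)] r(1) m by (simp add: power_one_over)
    qed
    moreover have "inj_on (\<lambda>r. x + (1/3::real) ^ r) {max R m..}"
      by (rule inj_onI) (simp add: power_inject_exp')
    then have "infinite ((\<lambda>r. x + (1/3::real) ^ r) ` {max R m..})"
      using finite_imageD infinite_Ici by blast
    ultimately show ?thesis using finite_subset by blast
  qed
  have "infinite {y \<in> level c. x < y \<and> y < x + e}" if "x \<in> level (c - 1 - int d)" "e > 0" for x d e
    using that
  proof (induction d arbitrary: x e)
    case 0 then show ?case using base[of x c e] by simp
  next
    case (Suc d)
    have "x \<in> level (c - 1 - int d - 1)" using Suc.prems(1) by (simp add: algebra_simps)
    from base[OF this Suc.prems(2)] obtain y where y: "y \<in> level (c - 1 - int d)" "x < y" "y < x + e"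
      using finite.emptyI by (metis (mono_tags, lifting) empty_Collect_eq)
    have "infinite {z \<in> level c. y < z \<and> z < y + (x + e - y)}" using y by (intro Suc.IH) auto
    moreover have "{z \<in> level c. y < z \<and> z < y + (x + e - y)} \<subseteq> {z \<in> level c. x < z \<and> z < x + e}" using y by auto
    ultimately show ?case using finite_subset by blast
  qed
  from this[of x "nat (c - 1 - tcpx x)" e] assms show ?thesis unfolding low_def level_def by simp
qed

section \<open>The closure of \<open>T0\<close>\<close>

lemma T0_eq: "T0 = level 2"
proof (intro equalityI subsetI)
  fix x assume "x \<in> T0"
  then obtain n k where "x = real n / 3 ^ k" "n > 0" "stable n" "cpx n = 3 * k + 2" unfolding T0_def by blast
  then show "x \<in> level 2" unfolding level_def using tern_frac[of n k] tcpx_eq[of n k] stable_iff[of n] by simp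
next
  fix x assume "x \<in> level 2"
  then have "x \<in> tern" "tcpx x = 2" unfolding level_def by auto
  then obtain n k where n: "n > 0" "x = real n / 3 ^ k" "stable_cpx n - 3 * int k = 2" by (metis ternE)
  \<comment> \<open>Enlarging numerator and denominator by \<open>3 ^ a\<close> makes the numerator
    stable without changing the fraction.\<close>
  obtain a where a: "stable (3 ^ a * n)" using stable_exists n by blast
  have "x = real (3 ^ a * n) / 3 ^ (a + k)" using n by (simp add: power_add)
  moreover have "cpx (3 ^ a * n) = 3 * (a + k) + 2" using stable_cpx_eq[OF a] n by simp
  moreover have "3 ^ a * n > 0" using n by simp
  ultimately show "x \<in> T0" unfolding T0_def using a by blast
qed

lemma closure_T0: "closure T0 = insert 0 (low 2)"
proof (rule antisym)
  have "T0 \<subseteq> insert 0 (low 2)" unfolding T0_eq level_eq by blast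
  then show "closure T0 \<subseteq> insert 0 (low 2)"
    using closure_minimal compact_imp_closed[OF compact_low] by blast
  have low: "low 2 \<subseteq> closure (level 2)"
  proof
    fix x assume x: "x \<in> low 2"
    show "x \<in> closure (level 2)"
    proof (cases "x \<in> level 2")
      case True then show ?thesis using closure_subset by blast
    next
      case False
      then have x1: "x \<in> low (2 - 1)" using x unfolding level_eq by blast
      have "\<exists>y\<in>level 2. dist y x < e" if "e > 0" for e
      proof -
        have "{y \<in> level 2. x < y \<and> y < x + e} \<noteq> {}" using level_near_infinite[OF x1 that] by force
        then show ?thesis by (force simp: dist_real_def)
      qed
      then show ?thesis unfolding closure_approachable by blast
    qed
  qed
  have "0 islimpt low 2" using derived_low[of 2] unfolding derived_def by (auto simp: islimpt_insert)
  then have "0 \<in> closure (low 2)" unfolding closure_def by blast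
  then have "0 \<in> closure (level 2)" using closure_mono[OF low] by (auto simp: closure_closure)
  then show "insert 0 (low 2) \<subseteq> closure T0" unfolding T0_eq using low by blast
qed

section \<open>The gauge, the ratio and the threshold function\<close>

lemma stab_gauge_raw_low:
  assumes "n > 0" shows "stab_gauge_raw (insert 0 (low 2)) 3 3 n = stable_cpx n - 2"
proof -
  \<comment> \<open>All admissible pairs give the same value, so the choice made by
    \<open>SOME\<close> is harmless; the \<open>- 2\<close> cancels in the normalisation.\<close>
  have iff: "real n / real 3 powi l \<in> Tlayer u (insert 0 (low 2)) \<longleftrightarrow> 3 * l - int u = stable_cpx n - 2" for l u
    using tern_scale[OF tern_of_nat[OF assms], of "- l"] tcpx_of_nat[OF assms]
    unfolding Tlayer_low level_def by (auto simp: power_int_minus divide_inverse)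
  define P where "P p \<longleftrightarrow> real n / real 3 powi fst p \<in> Tlayer (snd p) (insert 0 (low 2))" for p :: "int \<times> nat"
  \<comment> \<open>A witness for existence: with \<open>l = stable_cpx n\<close>, the required
    \<open>u\<close> is \<open>2 * l + 2\<close>, which is nonnegative.\<close>
  have "3 * stable_cpx n - int (nat (2 * stable_cpx n + 2)) = stable_cpx n - 2"
    using stable_cpx_nonneg[OF assms] by simp
  then have "P (stable_cpx n, nat (2 * stable_cpx n + 2))" unfolding P_def fst_conv snd_conv iff .
  then have "P (SOME p. P p)" by (rule someI)
  then show ?thesis unfolding stab_gauge_raw_def Let_def P_def[symmetric]
    unfolding P_def iff by (simp add: mult.commute)
qed

lemma stab_gauge_low: "n > 0 \<Longrightarrow> stab_gauge (insert 0 (low 2)) 3 3 n = stable_cpx n"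
  unfolding stab_gauge_def using stab_gauge_raw_low[of n] stab_gauge_raw_low[of 1] stable_cpx_1 by simp

lemma scale_low: "(\<lambda>x. 3 * x) ` insert 0 (low (c - 3)) = insert 0 (low c)"
proof -
  have "3 * x \<in> low c" if "x \<in> low (c - 3)" for x
    using that tern_scale[of x 1] unfolding low_def by (auto simp: mult.commute)
  moreover have "x \<in> (\<lambda>x. 3 * x) ` low (c - 3)" if "x \<in> low c" for x
    using that tern_scale[of x "- 1"] unfolding low_def
    by (intro image_eqI[of _ _ "x * 3 powi (- 1)"]) (auto simp: power_int_minus)
  ultimately show ?thesis by auto
qed

lemma low2_fractions:
  "low 2 = {real m / real 3 ^ k | m k. m > 0 \<and> \<not> 3 dvd m \<and> k \<ge> nat ((stable_cpx m) div 3)}"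
proof -
  \<comment> \<open>Because \<open>2\<close> is the largest remainder modulo \<open>3\<close>, the
    bound on the complexity is exactly a floor, and \<open>\<kappa> m\<close> is
    \<open>stable_cpx m div 3\<close>.\<close>
  have iff: "stable_cpx m - 3 * int k \<le> 2 \<longleftrightarrow> k \<ge> nat (stable_cpx m div 3)" if "m > 0" for m k
    using stable_cpx_nonneg[OF that] by (auto simp: nat_le_iff)
  show ?thesis
  proof (intro equalityI subsetI)
    fix x assume "x \<in> low 2"
    then have "x \<in> tern" "tcpx x \<le> 2" unfolding low_def by auto
    then obtain n k where n: "n > 0" "x = real n / 3 ^ k" "stable_cpx n - 3 * int k \<le> 2" by (metis ternE)
    obtain m where m: "n = 3 ^ multiplicity 3 n * m" "\<not> 3 dvd m"
      using multiplicity_decompose'[of n 3] n by auto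
    define j where "j = multiplicity 3 n"
    have m0: "m > 0" using m n by (cases m) auto
    have sc: "stable_cpx n = stable_cpx m + 3 * int j" using stable_cpx_pow3_mult[OF m0, of j] m j_def by simp
    \<comment> \<open>Nonnegativity of \<open>stable_cpx m\<close> gives
      \<open>3 * (j - k) \<le> 2\<close>, so no positive power of \<open>3\<close> is left in the
      numerator.\<close>
    have "j \<le> k" using sc n(3) stable_cpx_nonneg[OF m0] by linarith
    then have "x = real m / real 3 ^ (k - j)" using n(2) m(1) unfolding j_def[symmetric]
      by (simp add: power_diff)
    moreover have "k - j \<ge> nat (stable_cpx m div 3)"
      using iff[OF m0, of "k - j"] sc n(3) \<open>j \<le> k\<close> by simp
    ultimately show "x \<in> {real m / real 3 ^ k | m k. m > 0 \<and> \<not> 3 dvd m \<and> k \<ge> nat ((stable_cpx m) div 3)}"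
      using m0 m(2) by blast
  next
    fix x assume "x \<in> {real m / real 3 ^ k | m k. m > 0 \<and> \<not> 3 dvd m \<and> k \<ge> nat ((stable_cpx m) div 3)}"
    then obtain m k where m: "x = real m / 3 ^ k" "m > 0" "k \<ge> nat ((stable_cpx m) div 3)" by auto
    then show "x \<in> low 2" using tern_frac[OF m(2), of k] tcpx_eq[OF m(2), of k] iff[OF m(2), of k]
      unfolding low_def by simp
  qed
qed

section \<open>Cantor normal form coordinates\<close>

text \<open>Counting the points of \<open>level (c - u)\<close> that are at least \<open>x\<close> and come after the last point of
  \<open>low (c - u - 1)\<close> that is at least \<open>x\<close> gives the coefficient of \<open>\<omega>\<^sup>u\<close> in the position of \<open>x\<close>
  in \<open>low c\<close>. Positions are counted here from \<open>1\<close>.\<close>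

definition visible :: "int \<Rightarrow> real \<Rightarrow> real set" where
  "visible c x = {y \<in> level c. x \<le> y \<and> (\<forall>z\<in>low (c - 1). \<not> (x \<le> z \<and> z \<le> y))}"

definition coord :: "int \<Rightarrow> real \<Rightarrow> nat \<Rightarrow> nat" where
  "coord c x u = card (visible (c - int u) x)"

lemma level_subset_low: "level c \<subseteq> low c"
  unfolding level_eq by blast

lemma visible_subset: "visible c x \<subseteq> level c"
  unfolding visible_def by blast

text \<open>An accumulation point would lie in \<open>low (c - 1)\<close>, at or above
  \<open>x\<close> and below a visible point, which visibility forbids.\<close>

lemma finite_visible:
  assumes "x > 0" shows "finite (visible c x)"
proof (rule ccontr)
  assume inf: "infinite (visible c x)"
  have "visible c x \<subseteq> low c" "\<forall>s\<in>visible c x. x \<le> s"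
    using visible_subset level_subset_low unfolding visible_def by blast+
  from low_accumulates[OF inf this assms] obtain X :: "nat \<Rightarrow> real" and z
    where "\<And>n. X n \<in> visible c x" "z \<in> low (c - 1)" "\<And>n. X n > z" "x \<le> z" by metis
  then show False unfolding visible_def using less_imp_le by blast
qed

text \<open>Visibility depends on \<open>x\<close> only through the part of \<open>low c\<close>
  above it.\<close>

lemma visible_cong:
  assumes "y \<le> x" "\<And>w. w \<in> low c \<Longrightarrow> y \<le> w \<Longrightarrow> x \<le> w"
  shows "visible c x = visible c y"
proof -
  have sub: "low (c - 1) \<subseteq> low c" "level c \<subseteq> low c" using low_mono[of "c - 1" c] level_subset_low by auto
  have iff: "x \<le> w \<longleftrightarrow> y \<le> w" if "w \<in> low c" for w using assms that by (auto intro: order_trans)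
  have "(x \<le> v \<and> (\<forall>z\<in>low (c - 1). \<not> (x \<le> z \<and> z \<le> v))) \<longleftrightarrow>
      (y \<le> v \<and> (\<forall>z\<in>low (c - 1). \<not> (y \<le> z \<and> z \<le> v)))" if v: "v \<in> level c" for v
  proof -
    have "x \<le> v \<longleftrightarrow> y \<le> v" using iff v sub(2) by blast
    moreover have "x \<le> z \<longleftrightarrow> y \<le> z" if "z \<in> low (c - 1)" for z using iff that sub(1) by blast
    ultimately show ?thesis by simp
  qed
  then show ?thesis unfolding visible_def by blast
qed

lemma low_eventually_below:
  assumes "x > 0" shows "\<exists>U::nat. \<forall>u\<ge>U. \<forall>w\<in>low (c - int u). w < x"
proof -
  obtain U where U: "3 powr c / x ^ 3 < (3::real) ^ U" using real_arch_pow[of 3] by auto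
  have "w < x" if u: "U \<le> u" and w: "w \<in> low (c - int u)" for u w
  proof (rule power_less_imp_less_base[of _ 3])
    have "w ^ 3 \<le> 3 powr real_of_int (c - int u)" by (rule low_upper[OF w])
    also have "\<dots> = 3 powr c / 3 ^ u" by (simp add: powr_diff powr_realpow)
    also have "\<dots> \<le> 3 powr c / 3 ^ U" using u by (intro divide_left_mono power_increasing) auto
    also have "\<dots> < x ^ 3" using U assms by (simp add: field_simps)
    finally show "w ^ 3 < x ^ 3" .
  qed (use assms in simp)
  then show ?thesis by blast
qed

lemma coord_OmegaOmega:
  assumes "x > 0" shows "coord c x \<in> OmegaOmega"
proof -
  obtain U where U: "\<And>u w. U \<le> u \<Longrightarrow> w \<in> low (c - int u) \<Longrightarrow> w < x"
    using low_eventually_below[OF assms, of c] by blast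
  have "coord c x u = 0" if "U \<le> u" for u
  proof -
    have "visible (c - int u) x = {}"
      using U[OF that] level_subset_low[of "c - int u"] unfolding visible_def by force
    then show ?thesis unfolding coord_def by simp
  qed
  then have "{u. coord c x u \<noteq> 0} \<subseteq> {..<U}" by (metis (mono_tags) lessThan_iff mem_Collect_eq not_less subsetI)
  then show ?thesis unfolding OmegaOmega_def using finite_subset by blast
qed

text \<open>The positions first differ, from the top, at the largest \<open>u\<close> for which
  \<open>low (c - u)\<close> meets \<open>[y, x)\<close>. For larger exponents the visible sets
  coincide; at \<open>u\<close> the point found there is visible from \<open>y\<close> and not from
  \<open>x\<close>.\<close>

lemma coord_less:
  assumes "x \<in> low c" "y \<in> low c" "y < x"
  shows "oo_less (coord c x) (coord c y)"
proof -
  have pos: "x > 0" "y > 0" using assms low_pos by auto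
  define P where "P u \<longleftrightarrow> (\<exists>w\<in>low (c - int u). y \<le> w \<and> w < x)" for u
  have P0: "P 0" unfolding P_def using assms by auto
  obtain U where U: "\<And>u w. U \<le> u \<Longrightarrow> w \<in> low (c - int u) \<Longrightarrow> w < y"
    using low_eventually_below[OF pos(2), of c] by blast
  have bound: "\<forall>u. P u \<longrightarrow> u \<le> U"
  proof (intro allI impI, rule ccontr)
    fix u assume "P u" "\<not> u \<le> U"
    then show False using U[of u] unfolding P_def by force
  qed
  define u where "u = (GREATEST u. P u)"
  have u: "P u" unfolding u_def using GreatestI_nat[of P 0 U] P0 bound by blast
  have nP: "\<not> P v" if "v > u" for v
  proof
    assume "P v"
    then have "v \<le> u" unfolding u_def using Greatest_le_nat[of P v U] bound by blast
    then show False using that by simp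
  qed
  obtain w where w: "w \<in> low (c - int u)" "y \<le> w" "w < x" using u unfolding P_def by blast
  have gap: "x \<le> z" if "z \<in> low (c - int u - 1)" "y \<le> z" for z
    using nP[of "Suc u"] that unfolding P_def by (force simp: algebra_simps)
  have "visible (c - int u) x \<subset> visible (c - int u) y"
  proof
    show "visible (c - int u) x \<subseteq> visible (c - int u) y"
      unfolding visible_def using gap assms(3) by fastforce
    have "w \<in> visible (c - int u) y" unfolding visible_def level_eq using w gap[of w] gap by force
    moreover have "w \<notin> visible (c - int u) x" unfolding visible_def using w by simp
    ultimately show "visible (c - int u) x \<noteq> visible (c - int u) y" by blast
  qed
  then have "coord c x u < coord c y u"
    unfolding coord_def using finite_visible[OF pos(2)] by (intro psubset_card_mono) auto
  moreover have "coord c x j = coord c y j" if "j > u" for j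
  proof -
    have "visible (c - int j) x = visible (c - int j) y"
      using nP[OF that] assms(3) unfolding P_def by (intro visible_cong) auto
    then show ?thesis unfolding coord_def by simp
  qed
  ultimately show ?thesis unfolding oo_less_def by blast
qed

text \<open>With finite upper tails the set is a decreasing \<open>\<omega>\<close>-sequence, so
  every count occurs; the next element is the maximum of a finite segment below
  \<open>v\<close>.\<close>

lemma ex_nth_largest:
  fixes S :: "real set"
  assumes "infinite S" "\<And>v. v \<in> S \<Longrightarrow> finite {y \<in> S. v \<le> y}"
  shows "\<exists>v\<in>S. card {y \<in> S. v \<le> y} = Suc k"
proof (induction k)
  case 0
  obtain v where v: "v \<in> S" using assms(1) by fastforce
  define m where "m = Max {y \<in> S. v \<le> y}"
  have fin: "finite {y \<in> S. v \<le> y}" by (rule assms(2)[OF v])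
  have m: "m \<in> {y \<in> S. v \<le> y}" unfolding m_def using fin v by (intro Max_in) auto
  have "y \<le> m" if "y \<in> S" "v \<le> y" for y unfolding m_def using fin that by (intro Max_ge) auto
  then have "{y \<in> S. m \<le> y} = {m}" using m by force
  then show ?case using m by (intro bexI[of _ m]) auto
next
  case (Suc k)
  then obtain v where v: "v \<in> S" "card {y \<in> S. v \<le> y} = Suc k" by blast
  have fv: "finite {y \<in> S. v \<le> y}" by (rule assms(2)[OF v(1)])
  have "infinite (S - {y \<in> S. v \<le> y})" using assms(1) fv by simp
  then obtain s where s: "s \<in> S" "s < v" by (metis (no_types, lifting) Diff_iff ex_in_conv finite.emptyI mem_Collect_eq not_le)
  define m where "m = Max {y \<in> S. s \<le> y \<and> y < v}"
  have fin: "finite {y \<in> S. s \<le> y \<and> y < v}" by (rule finite_subset[OF _ assms(2)[OF s(1)]]) auto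
  have m: "m \<in> {y \<in> S. s \<le> y \<and> y < v}" unfolding m_def using fin s by (intro Max_in) auto
  have le: "y \<le> m" if "y \<in> S" "s \<le> y" "y < v" for y unfolding m_def using fin that by (intro Max_ge) auto
  have "{y \<in> S. m \<le> y} = insert m {y \<in> S. v \<le> y}"
  proof (intro equalityI subsetI)
    fix y assume y: "y \<in> {y \<in> S. m \<le> y}"
    show "y \<in> insert m {y \<in> S. v \<le> y}"
    proof (cases "v \<le> y")
      case False
      then have "y \<le> m" using y m by (intro le) auto
      then show ?thesis using y by simp
    qed (use y in simp)
  qed (use m in auto)
  moreover have "m \<notin> {y \<in> S. v \<le> y}" using m by simp
  ultimately have "card {y \<in> S. m \<le> y} = Suc (Suc k)" using v(2) fv by simp
  then show ?case using m by blast
qed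

text \<open>Coefficients are realised from the highest exponent down. \<open>M\<close> lies above
  all of \<open>low c\<close> and stands for position \<open>0\<close>, which no point has when
  counting from \<open>1\<close>.\<close>

lemma coord_surj_aux:
  fixes c :: int
  defines "M \<equiv> 3 powr (c / 3) + (1::real)"
  assumes "\<forall>i<u. f i = 0" "\<forall>i\<ge>u + d. f i = 0"
  shows "\<exists>x. (x \<in> low (c - int u) \<or> x = M) \<and> coord c x = f"
  using assms(2,3)
proof (induction d arbitrary: u f)
  case 0
  have M: "w < M" if "w \<in> low (c - int j)" for w j
    using low_le[of w c] low_mono[of "c - int j" c] that unfolding M_def by force
  have "coord c M i = 0" for i
  proof -
    have "visible (c - int i) M = {}"
      using M level_subset_low unfolding visible_def by force
    then show ?thesis unfolding coord_def by simp
  qed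
  moreover have "f i = 0" for i using 0 by (cases "i < u") auto
  ultimately have "coord c M = f" by (intro ext) simp
  then show ?case by blast
next
  case (Suc d)
  define g where "g = f(u := 0)"
  have "\<forall>i<Suc u. g i = 0" "\<forall>i\<ge>Suc u + d. g i = 0" unfolding g_def using Suc.prems by (auto simp: less_Suc_eq)
  from Suc.IH[OF this] obtain x where x: "x \<in> low (c - int (Suc u)) \<or> x = M" "coord c x = g" by blast
  have lowS: "low (c - int (Suc u)) = low (c - int u - 1)" by (simp add: algebra_simps)
  have xpos: "x > 0" using x(1) low_pos unfolding M_def by (auto intro: add_pos_pos)
  show ?case
  proof (cases "f u")
    case 0
    then have "g = f" unfolding g_def by (intro ext) simp
    then show ?thesis using x low_mono[of "c - int (Suc u)" "c - int u"] by (intro exI[of _ x]) auto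
  next
    case (Suc k)
    \<comment> \<open>Between \<open>w\<close> and \<open>x\<close> there is no point of
      \<open>low (c - u - 1)\<close>, while \<open>level (c - u)\<close> accumulates at
      \<open>w\<close>; so the points in between form a decreasing \<open>\<omega>\<close>-sequence,
      and its \<open>f u\<close>-th term has the desired coefficient.\<close>
    have "\<exists>w\<in>{w \<in> low (c - int u - 1). w < x}. \<forall>y\<in>{w \<in> low (c - int u - 1). w < x}. y \<le> w"
      using low_unbounded_below[OF xpos, of "c - int u - 1"] by (intro low_has_max[of _ "c - int u - 1"]) auto
    then obtain w where w: "w \<in> low (c - int u - 1)" "w < x"
      and wmax: "\<And>y. y \<in> low (c - int u - 1) \<Longrightarrow> y < x \<Longrightarrow> y \<le> w" by blast
    define S where "S = {y \<in> level (c - int u). w < y \<and> y < x}"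
    have "infinite S" using level_near_infinite[OF w(1), of "x - w"] w(2) unfolding S_def by simp
    moreover have "finite {y \<in> S. v \<le> y}" if v: "v \<in> S" for v
    proof (rule ccontr)
      assume inf: "infinite {y \<in> S. v \<le> y}"
      have v0: "w < v" "v > 0" using v low_pos[OF w(1)] unfolding S_def by auto
      have sub: "{y \<in> S. v \<le> y} \<subseteq> low (c - int u)" "\<forall>s\<in>{y \<in> S. v \<le> y}. v \<le> s"
        using level_subset_low unfolding S_def by auto
      from low_accumulates[OF inf sub v0(2)] obtain X :: "nat \<Rightarrow> real" and z
        where z: "\<And>n. X n \<in> {y \<in> S. v \<le> y}" "z \<in> low (c - int u - 1)" "\<And>n. X n > z" "v \<le> z" by metis
      have "z < x" using z(1)[of 0] z(3)[of 0] unfolding S_def by simp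
      then show False using wmax[OF z(2)] z(4) v0 by simp
    qed
    ultimately obtain v where v: "v \<in> S" "card {y \<in> S. v \<le> y} = Suc k" using ex_nth_largest by blast
    have v1: "v \<in> level (c - int u)" "w < v" "v < x" using v(1) unfolding S_def by auto
    have above: "x \<le> z" if "z \<in> low (c - int u - 1)" "v \<le> z" for z
    proof (rule ccontr)
      assume "\<not> x \<le> z"
      then show False using wmax[OF that(1)] that(2) v1 by simp
    qed
    have "coord c v i = f i" for i
    proof -
      consider "i < u" | "i = u" | "i > u" by linarith
      then show ?thesis
      proof cases
        case 1
        have "v \<in> low (c - int i - 1)"
          using v1(1) level_subset_low low_mono[of "c - int u" "c - int i - 1"] 1 by auto
        then have "visible (c - int i) v = {}" unfolding visible_def by auto
        then show ?thesis using Suc.prems(1) 1 unfolding coord_def by simp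
      next
        case 2
        have "visible (c - int u) v = {y \<in> S. v \<le> y}"
        proof (intro equalityI subsetI)
          fix y assume y: "y \<in> visible (c - int u) v"
          have "y < x"
          proof (rule ccontr)
            assume yx: "\<not> y < x"
            show False
            proof (cases "x = M")
              case True
              have "y \<in> low c" using y visible_subset level_subset_low low_mono[of "c - int u" c] by force
              then show False using low_le[of y c] yx True unfolding M_def by simp
            next
              case False
              then have "x \<in> low (c - int u - 1)" using x(1) lowS by blast
              then show False using y yx v1(3) unfolding visible_def by force
            qed
          qed
          then show "y \<in> {y \<in> S. v \<le> y}" using y v1 unfolding visible_def S_def by auto
        next
          fix y assume y: "y \<in> {y \<in> S. v \<le> y}"
          then show "y \<in> visible (c - int u) v" unfolding visible_def S_def using above by force
        qed
        then show ?thesis using 2 v(2) Suc unfolding coord_def by simp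
      next
        case 3
        have sub: "low (c - int i) \<subseteq> low (c - int u - 1)" using 3 by (intro low_mono) simp
        have "visible (c - int i) x = visible (c - int i) v"
          using v1(3) above sub by (intro visible_cong) auto
        then have "coord c v i = coord c x i" unfolding coord_def by simp
        then show ?thesis using x(2) 3 unfolding g_def by simp
      qed
    qed
    then have "coord c v = f" by (intro ext)
    then show ?thesis using v1(1) level_subset_low by blast
  qed
qed

lemma coord_surj:
  assumes "f \<in> OmegaOmega" "f i \<noteq> 0"
  shows "\<exists>x\<in>low c. coord c x = f"
proof -
  have fin: "finite {i. f i \<noteq> 0}" using assms(1) unfolding OmegaOmega_def by simp
  obtain d where d: "\<forall>i\<ge>d. f i = 0"
  proof -
    obtain d where "\<forall>i\<in>{i. f i \<noteq> 0}. i < d" using fin finite_nat_set_iff_bounded by blast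
    then have "\<forall>i\<ge>d. f i = 0" by force
    then show ?thesis by (rule that)
  qed
  obtain x where x: "x \<in> low (c - int 0) \<or> x = 3 powr (c / 3) + 1" "coord c x = f"
    using coord_surj_aux[of 0 f d c] d by auto
  \<comment> \<open>A nonzero coefficient excludes the auxiliary point, whose coordinates all
    vanish.\<close>
  have "x \<noteq> 3 powr (c / 3) + 1"
  proof
    assume xM: "x = 3 powr (c / 3) + 1"
    have "visible (c - int i) x \<noteq> {}" using assms(2) x(2) unfolding coord_def by force
    then obtain y where "y \<in> level (c - int i)" "x \<le> y" unfolding visible_def by blast
    then show False using low_le[of y c] level_subset_low low_mono[of "c - int i" c] xM by force
  qed
  then show ?thesis using x by auto
qed

lemma oo_less_irrefl: "\<not> oo_less f f"
  unfolding oo_less_def by simp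

lemma oo_less_asym: "oo_less f g \<Longrightarrow> \<not> oo_less g f"
  unfolding oo_less_def by (metis linorder_neqE_nat not_less_iff_gr_or_eq)

text \<open>Isolated points occupy the successor positions, limit points the limit
  positions.\<close>

lemma coord_0:
  assumes "x \<in> low c" shows "coord c x 0 \<noteq> 0 \<longleftrightarrow> x \<in> level c"
proof (cases "x \<in> level c")
  case True
  then have "x \<in> visible c x" unfolding visible_def level_eq by force
  then show ?thesis using True finite_visible[OF low_pos[OF assms], of c] unfolding coord_def by auto
next
  case False
  then have "x \<in> low (c - 1)" using assms unfolding level_eq by blast
  then have "visible c x = {}" unfolding visible_def by blast
  then show ?thesis using False unfolding coord_def by simp
qed

lemma coord_nonzero:
  assumes "x \<in> low c" shows "\<exists>i. coord c x i \<noteq> 0"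
proof -
  have x: "x \<in> tern" "tcpx x \<le> c" using assms unfolding low_def by auto
  then have "x \<in> level (c - int (nat (c - tcpx x)))" unfolding level_def by simp
  then have "x \<in> visible (c - int (nat (c - tcpx x))) x" unfolding visible_def level_eq by force
  then have "coord c x (nat (c - tcpx x)) \<noteq> 0"
    using finite_visible[OF low_pos[OF assms]] unfolding coord_def by auto
  then show ?thesis by blast
qed

text \<open>\<open>1 + \<alpha> = \<alpha>\<close> for infinite \<open>\<alpha>\<close>: the shift turns positions counted from \<open>1\<close> into positions
  counted from \<open>0\<close>.\<close>

definition shift :: "(nat \<Rightarrow> nat) \<Rightarrow> nat \<Rightarrow> nat" where
  "shift f = (if \<forall>i>0. f i = 0 then f(0 := f 0 - 1) else f)"

lemma shift_less:
  assumes "oo_less f g" "f j \<noteq> 0" shows "oo_less (shift f) (shift g)"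
proof -
  obtain i where i: "f i < g i" "\<forall>j>i. f j = g j" using assms(1) unfolding oo_less_def by blast
  show ?thesis
  proof (cases "i = 0")
    case True
    show ?thesis
    proof (cases "\<forall>i>0. f i = 0")
      case T: True
      \<comment> \<open>A finite nonzero position, so that the truncated \<open>f 0 - 1\<close> is a
        genuine predecessor.\<close>
      then have "f 0 > 0" using assms(2) by (cases j) auto
      then show ?thesis using i True T unfolding oo_less_def shift_def by (intro exI[of _ 0]) auto
    next
      case False
      then show ?thesis using i True unfolding oo_less_def shift_def by (intro exI[of _ 0]) auto
    qed
  next
    case False
    then have "g i \<noteq> 0" "i > 0" using i by auto
    then have "shift g = g" unfolding shift_def by auto
    moreover have "shift f k = f k" if "k > 0" for k using that unfolding shift_def by auto
    ultimately show ?thesis unfolding oo_less_def using i \<open>i > 0\<close> by (intro exI[of _ i]) auto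
  qed
qed

lemma OmegaOmega_update: "f \<in> OmegaOmega \<Longrightarrow> f(0 := k) \<in> OmegaOmega"
  unfolding OmegaOmega_def mem_Collect_eq
  by (rule finite_subset[of _ "insert 0 {i. f i \<noteq> 0}"]) auto

lemma shift_OmegaOmega: "f \<in> OmegaOmega \<Longrightarrow> shift f \<in> OmegaOmega"
  unfolding shift_def using OmegaOmega_update by auto

lemma shift_surj: "g \<in> OmegaOmega \<Longrightarrow> \<exists>f\<in>OmegaOmega. (\<exists>i. f i \<noteq> 0) \<and> shift f = g"
proof (cases "\<forall>i>0. g i = 0")
  case True
  assume g: "g \<in> OmegaOmega"
  have "shift (g(0 := Suc (g 0))) = g" unfolding shift_def using True by auto
  then show ?thesis using OmegaOmega_update[OF g] by (intro bexI[of _ "g(0 := Suc (g 0))"]) auto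
next
  case False
  assume g: "g \<in> OmegaOmega"
  have "shift g = g" unfolding shift_def using False by auto
  then show ?thesis using g False by (intro bexI[of _ g]) auto
qed

lemma order_type_low: "order_type_oo1 (insert 0 (low c))"
proof -
  define h where "h x = (if x = 0 then None else Some (shift (coord c x)))" for x :: real
  have h0: "h 0 = None" unfolding h_def by simp
  have hx: "h x = Some (shift (coord c x))" "x \<noteq> 0" if "x \<in> low c" for x
    using low_pos[OF that] unfolding h_def by auto
  have less: "oo1_less (h x) (h y)" if x: "x \<in> insert 0 (low c)" and y: "y \<in> insert 0 (low c)" and yx: "y < x" for x y
  proof -
    have xl: "x \<in> low c" using x y yx low_pos[of y c] by auto
    show ?thesis
    proof (cases "y = 0")
      case True then show ?thesis using hx(1)[OF xl] h0 by simp
    next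
      case False
      then have yl: "y \<in> low c" using y by simp
      obtain i where "coord c x i \<noteq> 0" using coord_nonzero[OF xl] by blast
      from shift_less[OF coord_less[OF xl yl yx] this] show ?thesis using hx(1)[OF xl] hx(1)[OF yl] by simp
    qed
  qed
  have asym: "\<not> oo1_less q p" if "oo1_less p q" for p q
    using that oo_less_asym by (cases p; cases q) auto
  have irrefl: "\<not> oo1_less p p" for p using asym by blast
  have iff: "x > y \<longleftrightarrow> oo1_less (h x) (h y)" if "x \<in> insert 0 (low c)" "y \<in> insert 0 (low c)" for x y
    using less[OF that] less[OF that(2,1)] asym irrefl by (metis linorder_neqE)
  have inj: "inj_on h (insert 0 (low c))"
  proof (rule inj_onI)
    fix x y assume "x \<in> insert 0 (low c)" "y \<in> insert 0 (low c)" "h x = h y"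
    then show "x = y" using iff[of x y] iff[of y x] irrefl by (metis linorder_neqE)
  qed
  have img: "h ` low c = Some ` OmegaOmega"
  proof (intro equalityI subsetI)
    fix p assume "p \<in> h ` low c"
    then obtain x where "x \<in> low c" "p = h x" by blast
    then show "p \<in> Some ` OmegaOmega"
      using hx(1)[of x] shift_OmegaOmega[OF coord_OmegaOmega[OF low_pos[of x c]]] by auto
  next
    fix p assume "p \<in> Some ` OmegaOmega"
    then obtain g where g: "g \<in> OmegaOmega" "p = Some g" by blast
    obtain f i where f: "f \<in> OmegaOmega" "f i \<noteq> 0" "shift f = g" using shift_surj[OF g(1)] by blast
    obtain x where "x \<in> low c" "coord c x = f" using coord_surj[OF f(1,2)] by blast
    then show "p \<in> h ` low c" using hx(1)[of x] f(3) g(2) by (intro image_eqI[of _ _ x]) auto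
  qed
  have "bij_betw h (insert 0 (low c)) (Some ` OmegaOmega \<union> {None})"
    unfolding bij_betw_def using inj img h0 by auto
  then show ?thesis unfolding order_type_oo1_def using iff by (intro exI[of _ h]) blast
qed

lemma quasi_arithmetic_low: "quasi_arithmetic (insert 0 (low 2)) 3 3"
proof -
  have "insert 0 (low 2) - {0} = low 2" using low_pos[of 0 2] by auto
  moreover have "insert 0 (low 2) \<subseteq> {0..}" using low_pos[of _ 2] by (auto intro: less_imp_le)
  then have "self_similar (insert 0 (low 2)) (real 3) 3"
    unfolding self_similar_def iter_derived_low
    using compact_low rev_well_ordered_low order_type_low scale_low[of 2] by simp
  ultimately show ?thesis unfolding quasi_arithmetic_def using low2_fractions
    by (intro conjI exI[of _ "\<lambda>m. nat (stable_cpx m div 3)"]) simp_all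
qed

section \<open>Positions within a level\<close>

text \<open>Counted from \<open>1\<close>, the points of \<open>level c\<close> are exactly the
  successor positions in \<open>low c\<close>. Omitting the limit positions turns
  \<open>\<omega> * \<beta> + (n + 1)\<close> into \<open>\<omega> * \<beta> + n\<close>, for
  infinite positions too, where \<open>shift\<close> changes nothing.\<close>

definition pos :: "int \<Rightarrow> real \<Rightarrow> nat \<Rightarrow> nat" where
  "pos c x = (coord c x)(0 := coord c x 0 - 1)"

lemma pos_OmegaOmega: "x \<in> level c \<Longrightarrow> pos c x \<in> OmegaOmega"
  unfolding pos_def using OmegaOmega_update coord_OmegaOmega low_pos level_subset_low by blast

lemma pos_less:
  assumes "x \<in> level c" "y \<in> level c" "y < x"
  shows "oo_less (pos c x) (pos c y)"
proof -
  have xl: "x \<in> low c" "y \<in> low c" using assms level_subset_low by auto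
  obtain i where i: "coord c x i < coord c y i" "\<forall>j>i. coord c x j = coord c y j"
    using coord_less[OF xl assms(3)] unfolding oo_less_def by blast
  have "coord c x 0 \<noteq> 0" using coord_0[OF xl(1)] assms(1) by simp
  then have "pos c x i < pos c y i" using i(1) unfolding pos_def by (cases "i = 0") auto
  moreover have "\<forall>j>i. pos c x j = pos c y j" using i(2) unfolding pos_def by auto
  ultimately show ?thesis unfolding oo_less_def by blast
qed

lemma pos_less_iff:
  assumes "x \<in> level c" "y \<in> level c"
  shows "oo_less (pos c x) (pos c y) \<longleftrightarrow> y < x"
  using pos_less[OF assms] pos_less[OF assms(2,1)] oo_less_asym oo_less_irrefl
  by (cases x y rule: linorder_cases) auto

lemma pos_inj:
  assumes "x \<in> level c" "y \<in> level c" "pos c x = pos c y" shows "x = y"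
  using pos_less_iff[OF assms(1,2)] pos_less_iff[OF assms(2,1)] assms(3) oo_less_irrefl
  by (cases x y rule: linorder_cases) auto

lemma pos_surj:
  assumes "f \<in> OmegaOmega" shows "\<exists>x\<in>level c. pos c x = f"
proof -
  have "f(0 := Suc (f 0)) \<in> OmegaOmega" "(f(0 := Suc (f 0))) 0 \<noteq> 0" using OmegaOmega_update[OF assms] by auto
  from coord_surj[OF this] obtain x where x: "x \<in> low c" "coord c x = f(0 := Suc (f 0))" by blast
  have "x \<in> level c" using coord_0[OF x(1)] x(2) by simp
  moreover have "pos c x = f" unfolding pos_def x(2) by auto
  ultimately show ?thesis by blast
qed

text \<open>The classical proof that well ordered sets admit no isomorphism onto a proper initial
  segment, in the reverse order: the greatest point raised by \<open>j\<close> has a greater image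
  that is raised as well.\<close>

lemma initial_segment_map_not_less:
  fixes L :: "real set"
  assumes max: "\<And>A. A \<subseteq> L \<Longrightarrow> A \<noteq> {} \<Longrightarrow> \<exists>m\<in>A. \<forall>y\<in>A. y \<le> m"
    and x': "x' \<in> L"
    and j: "\<And>y. y \<in> L \<Longrightarrow> x < y \<Longrightarrow> j y \<in> L \<and> x' < j y"
    and mono: "\<And>y z. y \<in> L \<Longrightarrow> z \<in> L \<Longrightarrow> x < y \<Longrightarrow> x < z \<Longrightarrow> z < y \<Longrightarrow> j z < j y"
  shows "\<not> x < x'"
proof
  assume less: "x < x'"
  define A where "A = {y \<in> L. x < y \<and> y < j y}"
  have "x' \<in> A" unfolding A_def using x' less j[OF x' less] by simp
  moreover have "A \<subseteq> L" unfolding A_def by blast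
  ultimately obtain m where m: "m \<in> A" "\<forall>y\<in>A. y \<le> m" using max[of A] by blast
  have m': "m \<in> L" "x < m" "m < j m" using m(1) unfolding A_def by auto
  have jm: "j m \<in> L" "x < j m" using j[OF m'(1,2)] m' by auto
  have "j m < j (j m)" by (rule mono[OF jm(1) m'(1) jm(2) m'(2) m'(3)])
  then have "j m \<in> A" unfolding A_def using jm by simp
  then show False using m(2) m'(3) by force
qed

text \<open>\<open>is_pos\<close> allows any isomorphism, so uniqueness must be shown. Composing a
  given one with \<open>pos\<close>, in both directions, compares the segments above
  \<open>x\<close> and above the point with \<open>pos\<close> equal to \<open>\<alpha>\<close>; the
  preceding lemma excludes either inequality.\<close>

lemma is_pos_level_iff: "is_pos (level c) \<alpha> x \<longleftrightarrow> x \<in> level c \<and> pos c x = \<alpha>"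
proof
  assume "x \<in> level c \<and> pos c x = \<alpha>"
  then have x: "x \<in> level c" "pos c x = \<alpha>" by auto
  have "bij_betw (pos c) {y \<in> level c. y > x} {\<beta> \<in> OmegaOmega. oo_less \<beta> \<alpha>}"
    unfolding bij_betw_def
  proof (intro conjI equalityI subsetI)
    show "inj_on (pos c) {y \<in> level c. y > x}" using pos_inj by (auto intro!: inj_onI)
  next
    fix \<beta> assume "\<beta> \<in> pos c ` {y \<in> level c. y > x}"
    then obtain y where "y \<in> level c" "x < y" "\<beta> = pos c y" by blast
    then show "\<beta> \<in> {\<beta> \<in> OmegaOmega. oo_less \<beta> \<alpha>}" using pos_less[of y c x] x pos_OmegaOmega by auto
  next
    fix \<beta> assume b: "\<beta> \<in> {\<beta> \<in> OmegaOmega. oo_less \<beta> \<alpha>}"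
    then obtain y where y: "y \<in> level c" "pos c y = \<beta>" using pos_surj[of \<beta> c] by blast
    then have "x < y" using pos_less_iff[OF y(1) x(1)] b x by simp
    then show "\<beta> \<in> pos c ` {y \<in> level c. y > x}" using y by blast
  qed
  moreover have "\<forall>y\<in>{y \<in> level c. y > x}. \<forall>z\<in>{y \<in> level c. y > x}. y > z \<longleftrightarrow> oo_less (pos c y) (pos c z)"
    using pos_less_iff by auto
  moreover have "\<alpha> \<in> OmegaOmega" using pos_OmegaOmega[OF x(1)] x(2) by simp
  ultimately show "is_pos (level c) \<alpha> x"
    unfolding is_pos_def using x(1) by (intro conjI exI[of _ "pos c"])
next
  assume "is_pos (level c) \<alpha> x"
  then obtain h where x: "x \<in> level c" and \<alpha>: "\<alpha> \<in> OmegaOmega"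
    and h: "bij_betw h {y \<in> level c. y > x} {\<beta> \<in> OmegaOmega. oo_less \<beta> \<alpha>}"
    and hiff: "\<And>y z. y \<in> level c \<Longrightarrow> x < y \<Longrightarrow> z \<in> level c \<Longrightarrow> x < z \<Longrightarrow> y > z \<longleftrightarrow> oo_less (h y) (h z)"
    unfolding is_pos_def by auto
  obtain x' where x': "x' \<in> level c" "pos c x' = \<alpha>" using pos_surj[OF \<alpha>, of c] by blast
  have max: "\<exists>m\<in>A. \<forall>y\<in>A. y \<le> m" if "A \<subseteq> level c" "A \<noteq> {}" for A
    using low_has_max[of A c] that level_subset_low by blast
  have "\<exists>j. \<forall>y. y \<in> level c \<and> x < y \<longrightarrow> (j y \<in> level c \<and> x' < j y) \<and> pos c (j y) = h y"
  proof (intro choice allI)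
    fix y
    show "\<exists>w. y \<in> level c \<and> x < y \<longrightarrow> (w \<in> level c \<and> x' < w) \<and> pos c w = h y"
    proof (cases "y \<in> level c \<and> x < y")
      case True
      then have hy: "h y \<in> OmegaOmega" "oo_less (h y) \<alpha>" using bij_betwE[OF h] by auto
      obtain w where w: "w \<in> level c" "pos c w = h y" using pos_surj[OF hy(1), of c] by blast
      have "x' < w" using pos_less_iff[OF w(1) x'(1)] w(2) x'(2) hy(2) by simp
      then show ?thesis using w by blast
    next
      case False
      then show ?thesis by blast
    qed
  qed
  then obtain j where j: "\<And>y. y \<in> level c \<Longrightarrow> x < y \<Longrightarrow> (j y \<in> level c \<and> x' < j y) \<and> pos c (j y) = h y" by blast
  have "\<not> x < x'"
  proof (rule initial_segment_map_not_less[OF max x'(1), where j = j])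
    show "j y \<in> level c \<and> x' < j y" if "y \<in> level c" "x < y" for y using j[OF that] by blast
    show "j z < j y" if yz: "y \<in> level c" "z \<in> level c" "x < y" "x < z" "z < y" for y z
    proof -
      have "oo_less (pos c (j y)) (pos c (j z))"
        using hiff[OF yz(1,3,2,4)] yz(5) j[OF yz(1,3)] j[OF yz(2,4)] by simp
      then show ?thesis using pos_less_iff[of "j y" c "j z"] j[OF yz(1,3)] j[OF yz(2,4)] by simp
    qed
  qed
  define k where "k y = inv_into {y \<in> level c. y > x} h (pos c y)" for y
  have k: "k y \<in> level c" "x < k y" "h (k y) = pos c y" if y: "y \<in> level c" "x' < y" for y
  proof -
    have "pos c y \<in> h ` {y \<in> level c. y > x}"
      using bij_betw_imp_surj_on[OF h] pos_OmegaOmega[OF y(1)] pos_less[OF y(1) x'(1) y(2)] x'(2) by simp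
    then show "k y \<in> level c" "x < k y" "h (k y) = pos c y"
      unfolding k_def using inv_into_into[of "pos c y" h "{y \<in> level c. y > x}"] f_inv_into_f[of "pos c y" h "{y \<in> level c. y > x}"]
      by auto
  qed
  have "\<not> x' < x"
  proof (rule initial_segment_map_not_less[OF max x, where j = k])
    show "k y \<in> level c \<and> x < k y" if "y \<in> level c" "x' < y" for y using k(1,2)[OF that] by blast
    show "k z < k y" if yz: "y \<in> level c" "z \<in> level c" "x' < y" "x' < z" "z < y" for y z
      using hiff[OF k(1,2)[OF yz(1,3)] k(1,2)[OF yz(2,4)]] k(3)[OF yz(1,3)] k(3)[OF yz(2,4)]
        pos_less[OF yz(1,2,5)] by simp
  qed
  then have "x = x'" using \<open>\<not> x < x'\<close> by simp
  then show "x \<in> level c \<and> pos c x = \<alpha>" using x' by simp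
qed

text \<open>For \<open>x\<close> in \<open>level (c - 1)\<close> at position
  \<open>\<alpha>\<close>, these are the points at the positions
  \<open>\<omega> * \<alpha> + r\<close> of \<open>level c\<close>.\<close>

definition block :: "int \<Rightarrow> real \<Rightarrow> real set" where
  "block c x = {y \<in> level c. x < y \<and> (\<forall>z\<in>low (c - 1). \<not> (x < z \<and> z \<le> y))}"

lemma block_base_exists:
  assumes y: "y \<in> level c"
  obtains p where "p \<in> level (c - 1)" "y \<in> block c p"
proof -
  have y0: "y > 0" using y level_subset_low low_pos by blast
  have "\<exists>w\<in>{w \<in> low (c - 1). w < y}. \<forall>z\<in>{w \<in> low (c - 1). w < y}. z \<le> w"
    using low_unbounded_below[OF y0, of "c - 1"] by (intro low_has_max[of _ "c - 1"]) auto
  then obtain p where p: "p \<in> low (c - 1)" "p < y" and pmax: "\<And>z. z \<in> low (c - 1) \<Longrightarrow> z < y \<Longrightarrow> z \<le> p" by blast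
  \<comment> \<open>Otherwise points of \<open>level (c - 1)\<close> would accumulate at
    \<open>p\<close>, and one of them would lie between \<open>p\<close> and
    \<open>y\<close>.\<close>
  have "p \<notin> low (c - 1 - 1)"
  proof
    assume "p \<in> low (c - 1 - 1)"
    from level_near_infinite[OF this, of "y - p"] p(2)
    have "{z \<in> level (c - 1). p < z \<and> z < y} \<noteq> {}" by force
    then obtain z where "z \<in> level (c - 1)" "p < z" "z < y" by blast
    then show False using pmax[of z] level_subset_low by force
  qed
  then have pl: "p \<in> level (c - 1)" using p(1) unfolding level_eq by blast
  have "y \<notin> low (c - 1)" using y unfolding level_eq by blast
  then have "\<not> (p < z \<and> z \<le> y)" if "z \<in> low (c - 1)" for z
    using pmax[OF that] that by (cases "z = y") auto
  then have "y \<in> block c p" unfolding block_def using y p(2) by blast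
  then show thesis using that pl by blast
qed

text \<open>Passing from \<open>c\<close> to \<open>c - 1\<close> lowers each exponent by one, which
  is the multiplication by \<open>\<omega>\<close>; nothing of \<open>low (c - 1)\<close> separates
  \<open>p\<close> from \<open>y\<close>.\<close>

lemma block_pos:
  assumes "p \<in> level (c - 1)" "y \<in> block c p"
  shows "pos c y = oo_omega_mult_plus (pos (c - 1) p) (pos c y 0)"
proof
  fix i
  have y: "y \<in> level c" "p < y" and ymin: "\<And>z. z \<in> low (c - 1) \<Longrightarrow> p < z \<Longrightarrow> y \<le> z"
    using assms(2) unfolding block_def by force+
  have p: "p \<in> low (c - 1)" "p \<notin> low (c - 1 - 1)" using assms(1) unfolding level_eq by auto
  have ny: "y \<notin> low (c - 1)" using y unfolding level_eq by blast
  have "y > 0" using y level_subset_low low_pos by blast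
  have sub: "low (c - 1 - 1) \<subseteq> low (c - 1)" by (intro low_mono) simp
  show "pos c y i = oo_omega_mult_plus (pos (c - 1) p) (pos c y 0) i"
  proof (cases i)
    case 0 then show ?thesis unfolding oo_omega_mult_plus_def by simp
  next
    case (Suc u)
    have cu: "c - int (Suc u) = c - 1 - int u" by simp
    show ?thesis
    proof (cases u)
      case 0
      \<comment> \<open>Counting from \<open>p\<close> includes \<open>p\<close> itself; the
        \<open>- 1\<close> in \<open>pos (c - 1) p\<close> compensates for it.\<close>
      have "visible (c - 1) p = insert p (visible (c - 1) y)"
      proof (intro equalityI subsetI)
        fix v assume v: "v \<in> visible (c - 1) p"
        show "v \<in> insert p (visible (c - 1) y)"
        proof (cases "v = p")
          case False
          have vv: "v \<in> level (c - 1)" "p \<le> v" "\<forall>z\<in>low (c - 1 - 1). \<not> (p \<le> z \<and> z \<le> v)"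
            using v unfolding visible_def by auto
          have "y \<le> v" using ymin[of v] vv False level_subset_low by force
          moreover have "\<not> (y \<le> z \<and> z \<le> v)" if "z \<in> low (c - 1 - 1)" for z using vv(3) that y(2) by force
          ultimately show ?thesis using vv(1) unfolding visible_def by blast
        qed simp
      next
        fix v assume "v \<in> insert p (visible (c - 1) y)"
        then show "v \<in> visible (c - 1) p"
        proof
          assume "v = p"
          then show ?thesis using assms(1) p unfolding visible_def by force
        next
          assume v: "v \<in> visible (c - 1) y"
          have vv: "v \<in> level (c - 1)" "y \<le> v" "\<forall>z\<in>low (c - 1 - 1). \<not> (y \<le> z \<and> z \<le> v)"
            using v unfolding visible_def by auto
          have "\<not> (p \<le> z \<and> z \<le> v)" if z: "z \<in> low (c - 1 - 1)" for z
          proof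
            assume zz: "p \<le> z \<and> z \<le> v"
            have "z \<noteq> p" using z p(2) by blast
            then have "y \<le> z" using ymin[of z] z sub zz by force
            then show False using vv(3) z zz by blast
          qed
          then show ?thesis unfolding visible_def using vv y(2) by force
        qed
      qed
      moreover have "p \<notin> visible (c - 1) y" using y(2) unfolding visible_def by simp
      ultimately have "card (visible (c - 1) p) = Suc (card (visible (c - 1) y))"
        using finite_visible[OF \<open>y > 0\<close>, of "c - 1"] by simp
      then show ?thesis unfolding pos_def coord_def oo_omega_mult_plus_def Suc 0 by simp
    next
      case (Suc v)
      have "visible (c - 1 - int u) y = visible (c - 1 - int u) p"
      proof (rule visible_cong)
        fix w assume w: "w \<in> low (c - 1 - int u)" "p \<le> w"
        have "w \<in> low (c - 1 - 1)" using w(1) low_mono[of "c - 1 - int u" "c - 1 - 1"] Suc by auto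
        then have "w \<noteq> p" "w \<in> low (c - 1)" using p(2) sub by auto
        then show "y \<le> w" using ymin[of w] w(2) by simp
      qed (use y in simp)
      then show ?thesis unfolding pos_def coord_def oo_omega_mult_plus_def using \<open>i = Suc u\<close> Suc cu
        by (simp add: diff_diff_eq add.commute)
    qed
  qed
qed

lemma positions_eq_block:
  assumes "x \<in> level (c - 1)"
  shows "{y. \<exists>r. is_pos (level c) (oo_omega_mult_plus (pos (c - 1) x) r) y} = block c x"
proof (intro equalityI subsetI)
  fix y assume "y \<in> block c x"
  then show "y \<in> {y. \<exists>r. is_pos (level c) (oo_omega_mult_plus (pos (c - 1) x) r) y}"
    using block_pos[OF assms] unfolding is_pos_level_iff block_def by blast
next
  fix y assume "y \<in> {y. \<exists>r. is_pos (level c) (oo_omega_mult_plus (pos (c - 1) x) r) y}"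
  then obtain r where y: "y \<in> level c" "pos c y = oo_omega_mult_plus (pos (c - 1) x) r"
    unfolding is_pos_level_iff by blast
  obtain p where p: "p \<in> level (c - 1)" "y \<in> block c p" using block_base_exists[OF y(1)] .
  have eq: "oo_omega_mult_plus (pos (c - 1) p) (pos c y 0) = oo_omega_mult_plus (pos (c - 1) x) r"
    using block_pos[OF p] y(2) by simp
  have "pos (c - 1) p = pos (c - 1) x"
  proof
    fix i
    show "pos (c - 1) p i = pos (c - 1) x i"
      using fun_cong[OF eq, of "Suc i"] unfolding oo_omega_mult_plus_def by simp
  qed
  then have "p = x" by (rule pos_inj[OF p(1) assms])
  then show "y \<in> block c x" using p by simp
qed

section \<open>The arithmetic condition\<close>

lemma tern_normal_form:
  assumes "x \<in> tern"
  shows "\<exists>m e. m > 0 \<and> \<not> 3 dvd m \<and> x = real m * 3 powi e \<and> tcpx x = stable_cpx m + 3 * e"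
proof -
  obtain n k where n: "n > 0" "x = real n / 3 ^ k" using ternE[OF assms] by metis
  obtain m where m: "n = 3 ^ multiplicity 3 n * m" "\<not> 3 dvd m"
    using multiplicity_decompose'[of n 3] n by auto
  define j where "j = multiplicity 3 n"
  have m0: "m > 0" using m n by (cases m) auto
  have nm: "real n = 3 ^ j * real m" using m(1) unfolding j_def[symmetric] by simp
  have x: "x = real m * 3 powi (int j - int k)" unfolding n(2) nm by (simp add: power_int_diff)
  then have "tcpx x = stable_cpx m + 3 * (int j - int k)"
    using tern_scale(2)[OF tern_of_nat[OF m0]] tcpx_of_nat[OF m0] by simp
  then show ?thesis using x m0 m(2) by blast
qed

lemma pow3_mult_unique:
  fixes m n :: nat
  assumes "\<not> 3 dvd m" "\<not> 3 dvd n" "real m * 3 powi e = real n * 3 powi d"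
  shows "m = n" "e = d"
proof -
  have not_less: "\<not> e < d" if "\<not> 3 dvd m" "real m * 3 powi e = real n * 3 powi d" for m n :: nat and e d :: int
  proof
    assume less: "e < d"
    have "real m = real n * 3 powi (d - e)" using that(2) by (simp add: power_int_diff field_simps)
    also have "3 powi (d - e) = (3::real) ^ nat (d - e)" using less by (simp add: power_int_def)
    finally have "real m = real (n * 3 ^ nat (d - e))" by simp
    then have "m = n * 3 ^ nat (d - e)" by (simp only: of_nat_eq_iff)
    moreover have "3 dvd (3::nat) ^ nat (d - e)" using less by (simp add: dvd_power)
    ultimately show False using that(1) by simp
  qed
  show "e = d" using not_less[OF assms(1,3)] not_less[OF assms(2) assms(3)[symmetric]] by simp
  then show "m = n" using assms(3) by simp
qed

text \<open>The prescribed family with the gauge already replaced by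
  \<open>stable_cpx\<close>.\<close>

definition near_products :: "nat \<Rightarrow> nat \<Rightarrow> real set" where
  "near_products n k = {real b * (real a * real 3 ^ r + 1) / real 3 ^ (r + k) | a b r.
     a > 0 \<and> b > 0 \<and> n = a * b \<and> stable_cpx n = stable_cpx a + stable_cpx b}"

lemma near_product_eq:
  "real b * (real a * real 3 ^ r + 1) / real 3 ^ (r + k) = real b * (real a + 1 / 3 ^ r) * 3 powi (- int k)"
  by (simp add: power_add power_int_minus field_simps)

text \<open>Infinitely many exceptions would accumulate, and only at \<open>x\<close>, since a block
  is not separated from \<open>x\<close> by \<open>low (c - 1)\<close>. As \<open>x\<close> has
  complexity exactly \<open>c - 1\<close>, the approaching terms have the prescribed shape after
  removing powers of \<open>3\<close> from \<open>\<alpha>\<close> and \<open>\<beta>\<close>,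
  contradicting the choice.\<close>

lemma finite_block_diff:
  assumes x: "x \<in> level (c - 1)" "x = real n / 3 ^ k" and n: "n > 0" "\<not> 3 dvd n"
  shows "finite (block c x - near_products n k)"
proof (rule ccontr)
  assume inf: "infinite (block c x - near_products n k)"
  have x0: "x > 0" using x(1) level_subset_low low_pos by blast
  have tx: "tcpx x = c - 1" using x(1) unfolding level_def by simp
  have sub: "block c x - near_products n k \<subseteq> low c" "\<forall>s\<in>block c x - near_products n k. x \<le> s"
    using level_subset_low unfolding block_def by auto
  show False
  proof (rule low_accumulates[OF inf sub x0])
    fix X :: "nat \<Rightarrow> real" and z
    assume X: "\<And>n'. X n' \<in> block c x - near_products n k" and z: "z \<in> low (c - 1)"
      and lim: "X \<longlonglongrightarrow> z" and Xz: "\<And>n. X n > z" and xz: "x \<le> z"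
      and form: "tcpx z = c - 1 \<Longrightarrow> \<exists>\<alpha> \<beta>. good_factor z \<alpha> \<beta> \<and> (\<forall>n. \<exists>r::int. X n = \<beta> * (\<alpha> + 3 powi r))"
    have "z = x"
    proof (rule ccontr)
      assume "z \<noteq> x"
      then have "x < z" using xz by simp
      then show False using X[of 0] z Xz[of 0] unfolding block_def by force
    qed
    then obtain \<alpha> \<beta> where ab: "good_factor x \<alpha> \<beta>" and Xr: "\<forall>n. \<exists>r::int. X n = \<beta> * (\<alpha> + 3 powi r)"
      using form tx by auto
    have f: "\<alpha> \<in> tern" "\<beta> \<in> tern" "x = \<alpha> * \<beta>" "tcpx x = tcpx \<alpha> + tcpx \<beta>" using ab unfolding good_factor_def by auto
    obtain a i where a: "a > 0" "\<not> 3 dvd a" "\<alpha> = real a * 3 powi i" "tcpx \<alpha> = stable_cpx a + 3 * i"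
      using tern_normal_form[OF f(1)] by blast
    obtain b j where b: "b > 0" "\<not> 3 dvd b" "\<beta> = real b * 3 powi j" "tcpx \<beta> = stable_cpx b + 3 * j"
      using tern_normal_form[OF f(2)] by blast
    have nd: "\<not> 3 dvd a * b" using a(2) b(2) prime_dvd_mult_iff[of "3::nat" a b] by simp
    have "real (a * b) * 3 powi (i + j) = real n * 3 powi (- int k)"
      using f(3) x(2) unfolding a(3) b(3) by (simp add: power_int_add power_int_minus field_simps)
    from pow3_mult_unique[OF nd n(2) this] have nab: "a * b = n" and ij: "i + j = - int k" .
    have "tcpx x = stable_cpx n - 3 * int k" unfolding x(2) by (rule tcpx_eq[OF n(1)])
    then have sc: "stable_cpx n = stable_cpx a + stable_cpx b" using f(4) a(4) b(4) ij by simp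
    have "X \<longlonglongrightarrow> x" using lim \<open>z = x\<close> by simp
    \<comment> \<open>Closeness within \<open>1 / 3 ^ k\<close> forces
      \<open>real b * 3 powi (r - i) < 1\<close>, so \<open>i - r\<close> is a natural number and
      can serve as the exponent in \<open>near_products\<close>.\<close>
    then have "eventually (\<lambda>m. X m < x + 1 / 3 ^ k) sequentially" by (rule order_tendstoD) simp
    then obtain m where m: "X m < x + 1 / 3 ^ k" unfolding eventually_sequentially by blast
    obtain r where r: "X m = \<beta> * (\<alpha> + 3 powi r)" using Xr by blast
    have "\<beta> * 3 powi r = real b * 3 powi (r - i) * 3 powi (i + j)"
      unfolding b(3) by (simp add: power_int_add power_int_diff)
    also have "\<dots> = real b * 3 powi (r - i) / 3 ^ k" unfolding ij by (simp add: power_int_minus divide_inverse)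
    finally have br: "\<beta> * 3 powi r = real b * 3 powi (r - i) / 3 ^ k" .
    have Xm: "X m = x + real b * 3 powi (r - i) / 3 ^ k" unfolding r distrib_left br f(3) by simp
    then have small: "real b * 3 powi (r - i) < 1" using m by (simp add: divide_less_cancel)
    have "r - i \<le> 0"
    proof (rule ccontr)
      assume "\<not> r - i \<le> 0"
      then have "(1::real) \<le> 3 powi (r - i)" by (simp add: power_int_def)
      then have "1 * 1 \<le> real b * 3 powi (r - i)" using b(1) by (intro mult_mono) auto
      then show False using small by simp
    qed
    then obtain s where s: "r - i = - int s" by (metis neg_0_le_iff_le minus_minus nonneg_int_cases)
    have "X m = real b * (real a * real 3 ^ s + 1) / real 3 ^ (s + k)"
      unfolding Xm s x(2) nab[symmetric] by (simp add: power_int_minus power_add field_simps)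
    then have "X m \<in> near_products n k" unfolding near_products_def using a(1) b(1) nab sc by blast
    then show False using X[of m] by blast
  qed
qed

text \<open>Additivity of \<open>stable_cpx\<close> bounds the complexity of the terms by
  \<open>c\<close>. Conversely, \<open>x\<close> is isolated in \<open>low (c - 1)\<close>, so terms
  close to \<open>x\<close> avoid that set and are not separated from \<open>x\<close> by
  it.\<close>

lemma near_products_eventually_block:
  assumes x: "x \<in> level (c - 1)" "x = real n / 3 ^ k" and ab: "a > 0" "b > 0" "n = a * b"
    and sc: "stable_cpx n = stable_cpx a + stable_cpx b"
  shows "eventually (\<lambda>r. real b * (real a * real 3 ^ r + 1) / real 3 ^ (r + k) \<in> block c x) sequentially"
proof -
  have n: "n > 0" using ab by simp
  define Y where "Y r = real b * (real a * real 3 ^ r + 1) / real 3 ^ (r + k)" for r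
  have Yx: "Y r = x + (real b / 3 ^ k) * (1/3) ^ r" for r
    unfolding Y_def x(2) ab(3) by (simp add: power_add field_simps)
  have tx: "tcpx x = c - 1" using x(1) unfolding level_def by simp
  have tx': "tcpx x = stable_cpx n - 3 * int k" unfolding x(2) by (rule tcpx_eq[OF n])
  have "x \<noteq> 0" using x(1) level_subset_low low_pos by blast
  moreover have "x \<notin> low (c - 1 - 1)" using tx unfolding low_def by simp
  ultimately have "\<not> x islimpt low (c - 1)"
    using derived_low[of "c - 1"] unfolding derived_def by (auto simp: islimpt_insert)
  then obtain e where e: "e > 0" "\<And>z. z \<in> low (c - 1) \<Longrightarrow> z \<noteq> x \<Longrightarrow> \<not> dist z x < e"
    unfolding islimpt_approachable by blast
  have "(\<lambda>r. x + (real b / 3 ^ k) * (1/3) ^ r) \<longlonglongrightarrow> x + (real b / 3 ^ k) * 0"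
    by (intro tendsto_intros LIMSEQ_power_zero) auto
  then have "Y \<longlonglongrightarrow> x" unfolding Yx[abs_def] by simp
  then have ev1: "eventually (\<lambda>r. Y r < x + e) sequentially" using e(1) by (intro order_tendstoD(2)) auto
  have ev2: "eventually (\<lambda>r. real a + 1 / 3 ^ r \<in> tern \<and> tcpx (real a + 1 / 3 ^ r) \<le> tcpx (real a) + 1) sequentially"
    by (rule tern_add_small[OF tern_of_nat[OF ab(1)]])
  have "Y r \<in> block c x" if r: "Y r < x + e" "real a + 1 / 3 ^ r \<in> tern"
    "tcpx (real a + 1 / 3 ^ r) \<le> tcpx (real a) + 1" for r
  proof -
    have Yeq: "Y r = real b * (real a + 1 / 3 ^ r) * 3 powi (- int k)" unfolding Y_def by (rule near_product_eq)
    note bt = tern_mult[OF tern_of_nat[OF ab(2)] r(2)]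
    have Yt: "Y r \<in> tern" "tcpx (Y r) \<le> c"
      using tern_scale[OF bt(1), of "- int k"] bt(2) r(3) tcpx_of_nat[OF ab(1)] tcpx_of_nat[OF ab(2)] tx tx' sc
      unfolding Yeq by auto
    have xY: "x < Y r" unfolding Yx using ab(2) by simp
    have none: "\<not> (x < z \<and> z \<le> Y r)" if "z \<in> low (c - 1)" for z
      using e(2)[OF that] r(1) by (auto simp: dist_real_def)
    have "Y r \<notin> low (c - 1)" using none[of "Y r"] xY by blast
    then have "Y r \<in> level c" unfolding level_eq low_def using Yt by blast
    then show ?thesis unfolding block_def using xY none by blast
  qed
  with ev1 ev2 show ?thesis unfolding Y_def[symmetric] by (auto elim: eventually_elim2)
qed

text \<open>There are finitely many factorisations \<open>n = a * b\<close>, and each contributes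
  finitely many exceptional \<open>r\<close>.\<close>

lemma finite_near_products_diff:
  assumes x: "x \<in> level (c - 1)" "x = real n / 3 ^ k" and n: "n > 0"
  shows "finite (near_products n k - block c x)"
proof -
  define P where "P = {(a, b). a > 0 \<and> b > 0 \<and> n = a * b \<and> stable_cpx n = stable_cpx a + stable_cpx b}"
  define Y where "Y a b r = real b * (real a * real 3 ^ r + 1) / real 3 ^ (r + k)" for a b r
  have "P \<subseteq> {..n} \<times> {..n}" unfolding P_def using n by auto
  then have finP: "finite P" using finite_subset by blast
  have fin: "finite {r. Y a b r \<notin> block c x}" if "(a, b) \<in> P" for a b
  proof -
    have "eventually (\<lambda>r. Y a b r \<in> block c x) sequentially"
      unfolding Y_def using that unfolding P_def by (intro near_products_eventually_block[OF x]) auto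
    then show ?thesis
      using eventually_cofinite[of "\<lambda>r. Y a b r \<in> block c x"] by (simp add: cofinite_eq_sequentially)
  qed
  have "near_products n k - block c x \<subseteq> (\<Union>(a, b)\<in>P. Y a b ` {r. Y a b r \<notin> block c x})"
  proof
    fix y assume y: "y \<in> near_products n k - block c x"
    then obtain a b r where "(a, b) \<in> P" "y = Y a b r" unfolding near_products_def P_def Y_def by blast
    then show "y \<in> (\<Union>(a, b)\<in>P. Y a b ` {r. Y a b r \<notin> block c x})" using y by blast
  qed
  moreover have "finite (\<Union>(a, b)\<in>P. Y a b ` {r. Y a b r \<notin> block c x})" using finP fin by auto
  ultimately show ?thesis using finite_subset by blast
qed

lemma arithmetic_compact_low: "arithmetic_compact (insert 0 (low 2)) 3 3"
  unfolding arithmetic_compact_def Let_def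
proof (intro conjI quasi_arithmetic_low ballI allI impI)
  fix \<alpha> u n k x
  assume "is_pos (Tlayer (Suc u) (insert 0 (low 2))) \<alpha> x" and n: "n > 0" "\<not> 3 dvd n"
    and xn: "x = real n / real 3 ^ k"
  then have xp: "x \<in> level (2 - int u - 1)" "pos (2 - int u - 1) x = \<alpha>"
    unfolding Tlayer_low is_pos_level_iff by (auto simp: algebra_simps)
  have A: "{y. \<exists>r. is_pos (Tlayer u (insert 0 (low 2))) (oo_omega_mult_plus \<alpha> r) y} = block (2 - int u) x"
    unfolding Tlayer_low xp(2)[symmetric] by (rule positions_eq_block[OF xp(1)])
  have "{real b * (real a * real 3 ^ r + 1) / real 3 ^ (r + k) | a b r.
      a > 0 \<and> b > 0 \<and> n = a * b \<and> stab_gauge (insert 0 (low 2)) 3 3 n =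
        stab_gauge (insert 0 (low 2)) 3 3 a + stab_gauge (insert 0 (low 2)) 3 3 b} = near_products n k"
    unfolding near_products_def using stab_gauge_low n(1) by (intro Collect_cong) (metis (no_types, lifting))
  then show "finite (({y. \<exists>r. is_pos (Tlayer u (insert 0 (low 2))) (oo_omega_mult_plus \<alpha> r) y} -
      {real b * (real a * real 3 ^ r + 1) / real 3 ^ (r + k) | a b r.
      a > 0 \<and> b > 0 \<and> n = a * b \<and> stab_gauge (insert 0 (low 2)) 3 3 n =
        stab_gauge (insert 0 (low 2)) 3 3 a + stab_gauge (insert 0 (low 2)) 3 3 b}) \<union>
      ({real b * (real a * real 3 ^ r + 1) / real 3 ^ (r + k) | a b r.
      a > 0 \<and> b > 0 \<and> n = a * b \<and> stab_gauge (insert 0 (low 2)) 3 3 n =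
        stab_gauge (insert 0 (low 2)) 3 3 a + stab_gauge (insert 0 (low 2)) 3 3 b} -
      {y. \<exists>r. is_pos (Tlayer u (insert 0 (low 2))) (oo_omega_mult_plus \<alpha> r) y}))"
    unfolding A using finite_block_diff[OF xp(1) _ n, of k] finite_near_products_diff[OF xp(1) _ n(1), of k] xn
    by simp
qed

theorem mainTheorem8:
  shows "arithmetic_compact (closure T0) 3 3 \<and>
         (\<forall>n::nat. n > 0 \<longrightarrow> stab_gauge (closure T0) 3 3 n = stable_cpx n)"
  unfolding closure_T0 using arithmetic_compact_low stab_gauge_low by blast

end
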